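(* If $\gamma\subset\mathbb{R}^d$ is a self-similar arc with $\dim_H\gamma>1$, then $\gamma$ is a Whitney set.
   Context: An arc is a homeomorphic image of $[0,1]$. A contractive similitude of $\mathbb{R}^d$ is a map $\varphi$ with $|\varphi(x)-\varphi(y)|=\rho|x-y|$ for all $x,y$, for some $\rho\in(0,1)$. An arc $\gamma\subset\mathbb{R}^d$ is a self-similar arc if it is the attractor of a finite family of contractive similitudes $\{\varphi_i\}_{i=1}^N$ of $\mathbb{R}^d$ (i.e. $\gamma=\bigcup_{i=1}^N\varphi_i(\gamma)$) such that $\varphi_i(\gamma)\cap\varphi_j(\gamma)$ is a singleton when $|i-j|=1$ and $\varphi_i(\gamma)\cap\varphi_j(\gamma)=\emptyset$ when $|i-j|>1$. No open set condition is assumed. A compact connected set $F\subset\mathbb{R}^d$ is a Whitney set if there is a $C^1$ function $f:\mathbb{R}^d\to\mathbb{R}$ such that $\nabla f(x)=0$ for all $x\in F$ and $f|_F$ is not constant. $\dim_H$ denotes Hausdorff dimension. *)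

theory Defs
  imports "HOL-Analysis.Analysis"
begin

(* The s-th power of the diameter of U, with the usual conventions |{}|^s = 0 and 0^0 = 1,
   neither of which powr provides. *)
definition diam_pow :: "real \<Rightarrow> 'a::metric_space set \<Rightarrow> real" where
  "diam_pow s U = (if U = {} then 0 else if s = 0 then 1 else diameter U powr s)"

(* Boundedness is required explicitly because diameter takes an unspecified value
   on unbounded sets. *)
definition hausdorff_premeasure :: "real \<Rightarrow> real \<Rightarrow> 'a::metric_space set \<Rightarrow> ennreal" where
  "hausdorff_premeasure s \<delta> A =
     (INF U \<in> {U :: nat \<Rightarrow> 'a set. (\<forall>i. bounded (U i) \<and> diameter (U i) \<le> \<delta>) \<and> A \<subseteq> (\<Union>i. U i)}.
        (\<Sum>i. ennreal (diam_pow s (U i))))"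

definition hausdorff_outer_measure :: "real \<Rightarrow> 'a::metric_space set \<Rightarrow> ennreal" where
  "hausdorff_outer_measure s A = (SUP \<delta>\<in>{0<..}. hausdorff_premeasure s \<delta> A)"

definition hausdorff_dim :: "'a::metric_space set \<Rightarrow> ennreal" where
  "hausdorff_dim A = Inf (ennreal ` {s. 0 \<le> s \<and> hausdorff_outer_measure s A = 0})"

definition contractive_similitude :: "('a::metric_space \<Rightarrow> 'a) \<Rightarrow> bool" where
  "contractive_similitude \<phi> \<longleftrightarrow> (\<exists>\<rho>. 0 < \<rho> \<and> \<rho> < 1 \<and> (\<forall>x y. dist (\<phi> x) (\<phi> y) = \<rho> * dist x y))"

definition is_attractor :: "nat \<Rightarrow> (nat \<Rightarrow> 'a::metric_space \<Rightarrow> 'a) \<Rightarrow> 'a set \<Rightarrow> bool" where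
  "is_attractor N \<phi> A \<longleftrightarrow> A \<noteq> {} \<and> compact A \<and> A = (\<Union>i\<in>{1..N}. \<phi> i ` A)"

definition is_arc :: "'a::topological_space set \<Rightarrow> bool" where
  "is_arc \<gamma> \<longleftrightarrow> {0..1::real} homeomorphic \<gamma>"

definition self_similar_arc :: "'a::metric_space set \<Rightarrow> bool" where
  "self_similar_arc \<gamma> \<longleftrightarrow> is_arc \<gamma> \<and>
     (\<exists>N \<phi>. (\<forall>i\<in>{1..N}. contractive_similitude (\<phi> i)) \<and> is_attractor N \<phi> \<gamma> \<and>
       (\<forall>i\<in>{1..N}. \<forall>j\<in>{1..N}.
          (\<bar>int i - int j\<bar> = 1 \<longrightarrow> is_singleton (\<phi> i ` \<gamma> \<inter> \<phi> j ` \<gamma>)) \<and>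
          (\<bar>int i - int j\<bar> > 1 \<longrightarrow> \<phi> i ` \<gamma> \<inter> \<phi> j ` \<gamma> = {})))"

(* g is the gradient field of f; its continuity on the whole space says that f is C^1. *)
definition whitney_set :: "'a::real_inner set \<Rightarrow> bool" where
  "whitney_set F \<longleftrightarrow> compact F \<and> connected F \<and>
     (\<exists>(f :: 'a \<Rightarrow> real) (g :: 'a \<Rightarrow> 'a). (\<forall>x. GDERIV f x :> g x) \<and> continuous_on UNIV g \<and>
        (\<forall>x\<in>F. g x = 0) \<and> \<not> f constant_on F)"

end

theory Submission
  imports Defs
begin

text \<open>
  It is enough to find t > 1 and a nonconstant function f on the arc \<gamma> with
  |f x - f y| \<le> C |x - y|^t. Such an f has, at every point of \<gamma>, a first-order Taylor
  expansion with zero linear part, so in the spirit of Whitney's extension theorem it is the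
  restriction of a C^1 function whose gradient vanishes on \<gamma>. Three ingredients produce it.

  The exponent (exists_exponent_of_hausdorff_dim_gt). Let \<rho>_i be the contraction ratios.
  Covering \<gamma> by its pieces of level n shows that the s-dimensional measure of \<gamma> vanishes
  whenever \<Sum>i. \<rho>_i^s < 1. Since the dimension exceeds 1, some s > 1 has \<Sum>i. \<rho>_i^s \<ge> 1,
  and every t strictly between 1 and s then has \<Sum>i. \<rho>_i^t > 1.

  The function (exists_holder_function). The distribution function of the natural
  self-similar measure on \<gamma> can fail the estimate: two points of consecutive pieces may lie
  very close together although the subarc joining them is long, because the pieces may touch
  tangentially. The remedy is a measure that stays away from the ends of the pieces. Among the
  words of a large fixed length n, discard those whose piece contains an end point of \<gamma>. At
  most two words are lost, so the remaining set W still has \<Sum>w\<in>W. \<rho>_w^t \<ge> 1. Let f be the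
  distribution function, along \<gamma>, of the self-similar measure with weights proportional to
  \<rho>_w^t on the Cantor set generated by W. It is constant near both ends of \<gamma>, hence near both
  ends of every piece. So if f x \<noteq> f y and x, y do not share a piece of W, their parameters
  differ by a fixed amount, and |x - y| is bounded below. Points sharing a piece are
  pulled back by its similitude, which multiplies |f x - f y| by a factor at most \<rho>_w^t and
  |x - y| by exactly \<rho>_w. This carries the estimate to all scales.

  The extension (whitney_extension_of_superlinear_holder). Away from \<gamma> let F x be the average
  of the values f y over the points y of finer and finer finite nets of \<gamma>, weighted by
  |x - y|^(-2m) and by a factor decaying geometrically in the level of the net. Write \<delta> for
  the distance from x to \<gamma>. For large m the average is dominated by points y at distance
  \<delta>^\<kappa> with \<kappa> < 1 as close to 1 as desired. Since t > 1 there is room for this loss: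
  F differs from f at the nearest point by O(\<delta>^\<tau>) and |grad F x| = O(\<delta>^(\<tau> - 1)), where
  \<tau> = t \<kappa> > 1.
\<close>

section \<open>Pieces of an iterated function system\<close>

text \<open>
  The map attached to a word u is foldr \<phi> u, whose leftmost letter is applied last, so that
  the piece of a word lies inside the piece of its first letter.
\<close>
definition words :: "'i set \<Rightarrow> nat \<Rightarrow> 'i list set" where
  "words I n = {u. set u \<subseteq> I \<and> length u = n}"

lemma words_0 [simp]: "words I 0 = {[]}"
  by (auto simp: words_def)

lemma words_Suc: "words I (Suc n) = (\<lambda>(i, u). i # u) ` (I \<times> words I n)"
  by (auto simp: words_def length_Suc_conv image_iff)

lemma finite_words [simp]: "finite I \<Longrightarrow> finite (words I n)"
  unfolding words_def by (rule finite_lists_length_eq)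

lemma card_words: "finite I \<Longrightarrow> card (words I n) = card I ^ n"
  unfolding words_def by (rule card_lists_length_eq)

lemma sum_words_prod_list:
  fixes a :: "'i \<Rightarrow> real"
  shows "(\<Sum>u\<in>words I n. prod_list (map a u)) = (\<Sum>i\<in>I. a i) ^ n"
proof (induction n)
  case (Suc n)
  have "(\<Sum>u\<in>words I (Suc n). prod_list (map a u))
      = (\<Sum>(i, u)\<in>I \<times> words I n. a i * prod_list (map a u))"
    unfolding words_Suc
    by (subst sum.reindex) (auto simp: inj_on_def case_prod_unfold)
  also have "\<dots> = (\<Sum>i\<in>I. a i) * (\<Sum>u\<in>words I n. prod_list (map a u))"
    by (simp add: sum.cartesian_product [symmetric] sum_product)
  finally show ?case
    using Suc by simp
qed simp

lemma prod_list_map_powr: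
  fixes \<rho> :: "'i \<Rightarrow> real"
  assumes "\<And>i. i \<in> set u \<Longrightarrow> 0 \<le> \<rho> i"
  shows "prod_list (map \<rho> u) powr t = prod_list (map (\<lambda>i. \<rho> i powr t) u)"
  using assms
  by (induction u) (auto simp: powr_mult prod_list_nonneg)

lemma prod_list_map_pos:
  fixes \<rho> :: "'i \<Rightarrow> real"
  assumes "\<And>i. i \<in> set u \<Longrightarrow> 0 < \<rho> i"
  shows "0 < prod_list (map \<rho> u)"
  using assms by (induction u) auto

lemma prod_list_map_le_power:
  fixes \<rho> :: "'i \<Rightarrow> real"
  assumes "\<And>i. i \<in> set u \<Longrightarrow> 0 < \<rho> i \<and> \<rho> i \<le> r"
  shows "prod_list (map \<rho> u) \<le> r ^ length u"
  using assms
proof (induction u)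
  case (Cons i u)
  have "0 < prod_list (map \<rho> u)"
    using Cons.prems by (intro prod_list_map_pos) auto
  moreover have "prod_list (map \<rho> u) \<le> r ^ length u"
    using Cons by auto
  ultimately show ?case
    using Cons.prems[of i] by (auto intro!: mult_mono)
qed simp

lemma dist_foldr_similitudes:
  fixes \<phi> :: "'i \<Rightarrow> 'a::metric_space \<Rightarrow> 'a"
  assumes "\<And>i x y. i \<in> set u \<Longrightarrow> dist (\<phi> i x) (\<phi> i y) = \<rho> i * dist x y"
  shows "dist (foldr \<phi> u x) (foldr \<phi> u y) = prod_list (map \<rho> u) * dist x y"
  using assms by (induction u) (auto simp: mult.assoc)

lemma attractor_eq_Union_words:
  assumes "A = (\<Union>i\<in>I. \<phi> i ` A)"
  shows "A = (\<Union>u\<in>words I n. foldr \<phi> u ` A)"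
proof (induction n)
  case (Suc n)
  have "(\<Union>u\<in>words I (Suc n). foldr \<phi> u ` A)
      = (\<Union>i\<in>I. \<phi> i ` (\<Union>u\<in>words I n. foldr \<phi> u ` A))"
    unfolding words_Suc by (auto simp: image_iff) (metis comp_apply)+
  also have "\<dots> = A"
    using assms Suc by simp
  finally show ?case ..
qed simp

text \<open>
  Two words of the same length that differ in the first letter inherit the bound from the
  pieces of level one; a common first letter is cancelled by injectivity.
\<close>
lemma foldr_similitudes_overlap:
  assumes inj: "\<And>i. i \<in> I \<Longrightarrow> inj (\<phi> i)"
    and sub: "\<And>i. i \<in> I \<Longrightarrow> \<phi> i ` A \<subseteq> A"
    and overlap: "\<And>i j x y. \<lbrakk>i \<in> I; j \<in> I; i \<noteq> j; x \<in> \<phi> i ` A \<inter> \<phi> j ` A; y \<in> \<phi> i ` A \<inter> \<phi> j ` A\<rbrakk> \<Longrightarrow> x = y"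
    and "u \<in> words I n" "v \<in> words I n" "u \<noteq> v"
    and "x \<in> foldr \<phi> u ` A \<inter> foldr \<phi> v ` A" "y \<in> foldr \<phi> u ` A \<inter> foldr \<phi> v ` A"
  shows "x = y"
  using assms(4-8)
proof (induction n arbitrary: u v x y)
  case (Suc n)
  from Suc.prems obtain i u' j v' where uv: "u = i # u'" "v = j # v'" "i \<in> I" "j \<in> I"
    "u' \<in> words I n" "v' \<in> words I n"
    by (auto simp: words_Suc)
  have sub_word: "foldr \<phi> w ` A \<subseteq> A" if "set w \<subseteq> I" for w
    using that
  proof (induction w)
    case (Cons k w)
    then have "foldr \<phi> (k # w) ` A \<subseteq> \<phi> k ` A" by auto
    then show ?case using sub[of k] Cons.prems by auto
  qed simp
  have sets: "set u' \<subseteq> I" "set v' \<subseteq> I"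
    using uv by (auto simp: words_def)
  show ?case
  proof (cases "i = j")
    case True
    have "foldr \<phi> u ` A = \<phi> i ` foldr \<phi> u' ` A" "foldr \<phi> v ` A = \<phi> i ` foldr \<phi> v' ` A"
      by (simp_all add: uv True image_comp)
    then have "foldr \<phi> u ` A \<inter> foldr \<phi> v ` A = \<phi> i ` (foldr \<phi> u' ` A \<inter> foldr \<phi> v' ` A)"
      using image_Int[OF inj[OF uv(3)]] by metis
    with Suc.prems(4,5) have xy: "x \<in> \<phi> i ` (foldr \<phi> u' ` A \<inter> foldr \<phi> v' ` A)"
      "y \<in> \<phi> i ` (foldr \<phi> u' ` A \<inter> foldr \<phi> v' ` A)"
      by simp_all
    obtain x' where x': "x' \<in> foldr \<phi> u' ` A \<inter> foldr \<phi> v' ` A" "x = \<phi> i x'"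
      using xy(1) by (rule imageE)
    obtain y' where y': "y' \<in> foldr \<phi> u' ` A \<inter> foldr \<phi> v' ` A" "y = \<phi> i y'"
      using xy(2) by (rule imageE)
    have "u' \<noteq> v'" using Suc.prems(3) uv True by simp
    then show ?thesis
      using Suc.IH[OF uv(5,6) _ x'(1) y'(1)] x'(2) y'(2) by simp
  next
    case False
    have "x \<in> \<phi> i ` A \<inter> \<phi> j ` A" "y \<in> \<phi> i ` A \<inter> \<phi> j ` A"
      using Suc.prems(4,5) sub_word[OF sets(1)] sub_word[OF sets(2)] uv by auto
    then show ?thesis using overlap[OF uv(3,4) False] by blast
  qed
qed simp


section \<open>Hausdorff dimension and the exponent\<close>

lemma hausdorff_premeasure_le_finite_cover:
  assumes "finite J" and cover: "A \<subseteq> (\<Union>j\<in>J. V j)" and "0 \<le> \<delta>"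
    and V: "\<And>j. j \<in> J \<Longrightarrow> bounded (V j) \<and> diameter (V j) \<le> \<delta>"
  shows "hausdorff_premeasure s \<delta> A \<le> (\<Sum>j\<in>J. ennreal (diam_pow s (V j)))"
proof -
  obtain e where e: "bij_betw e {0..<card J} J"
    using \<open>finite J\<close> ex_bij_betw_nat_finite by blast
  define U where "U i = (if i < card J then V (e i) else {})" for i
  have eJ: "e i \<in> J" if "i < card J" for i
    using e that by (auto simp: bij_betw_def)
  have "A \<subseteq> (\<Union>i. U i)"
  proof
    fix x assume "x \<in> A"
    then obtain j where "j \<in> J" "x \<in> V j" using cover by auto
    moreover obtain i where "i < card J" "e i = j"
      using e \<open>j \<in> J\<close> by (metis atLeastLessThan_iff bij_betw_def imageE)
    ultimately show "x \<in> (\<Union>i. U i)" by (auto simp: U_def intro!: exI[of _ i])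
  qed
  moreover have "bounded (U i) \<and> diameter (U i) \<le> \<delta>" for i
    using V eJ \<open>0 \<le> \<delta>\<close> by (auto simp: U_def)
  ultimately have "hausdorff_premeasure s \<delta> A \<le> (\<Sum>i. ennreal (diam_pow s (U i)))"
    unfolding hausdorff_premeasure_def by (intro INF_lower) auto
  also have "\<dots> = (\<Sum>i\<in>{0..<card J}. ennreal (diam_pow s (U i)))"
    by (rule suminf_finite) (auto simp: U_def diam_pow_def)
  also have "\<dots> = (\<Sum>j\<in>J. ennreal (diam_pow s (V j)))"
    by (subst sum.reindex_bij_betw[OF e, symmetric]) (auto simp: U_def)
  finally show ?thesis .
qed

text \<open>
  The pieces of level n form a cover whose mesh is at most r^n times the diameter of A, and
  their s-th powers of diameters add up to at most (\<Sum>i. \<rho>_i^s)^n times a constant.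
\<close>
lemma hausdorff_outer_measure_attractor_eq_0:
  fixes A :: "'a::euclidean_space set"
  assumes "finite I" and A: "compact A" "A \<noteq> {}" "A = (\<Union>i\<in>I. \<phi> i ` A)"
    and sim: "\<And>i x y. i \<in> I \<Longrightarrow> dist (\<phi> i x) (\<phi> i y) = \<rho> i * dist x y"
    and \<rho>: "\<And>i. i \<in> I \<Longrightarrow> 0 < \<rho> i \<and> \<rho> i \<le> r" and r: "0 < r" "r < 1"
    and s: "0 < s" and less_1: "(\<Sum>i\<in>I. \<rho> i powr s) < 1"
  shows "hausdorff_outer_measure s A = 0"
proof -
  define D where "D = diameter A"
  have bA: "bounded A" using A(1) by (rule compact_imp_bounded)
  have D: "0 \<le> D" unfolding D_def by (rule diameter_ge_0[OF bA])
  define S where "S = (\<Sum>i\<in>I. \<rho> i powr s)"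
  have S: "0 \<le> S" "S < 1" using less_1 by (auto simp: S_def intro!: sum_nonneg)
  have "hausdorff_premeasure s \<delta> A = 0" if "\<delta> > 0" for \<delta>
  proof -
    have diam: "diameter (foldr \<phi> u ` A) \<le> prod_list (map \<rho> u) * D"
      and bdd: "bounded (foldr \<phi> u ` A)"
      and pos: "0 < prod_list (map \<rho> u)"
      and le: "prod_list (map \<rho> u) \<le> r ^ n"
      if "u \<in> words I n" for u n
    proof -
      have u: "set u \<subseteq> I" "length u = n" using that by (auto simp: words_def)
      have d: "dist (foldr \<phi> u x) (foldr \<phi> u y) = prod_list (map \<rho> u) * dist x y" for x y
        using u sim by (intro dist_foldr_similitudes) auto
      show pos: "0 < prod_list (map \<rho> u)" using u \<rho> by (intro prod_list_map_pos) auto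
      show "prod_list (map \<rho> u) \<le> r ^ n"
        using prod_list_map_le_power[of u \<rho> r] u \<rho> by auto
      have dA: "dist (foldr \<phi> u x) (foldr \<phi> u y) \<le> prod_list (map \<rho> u) * D" if "x \<in> A" "y \<in> A" for x y
        unfolding d D_def using diameter_bounded_bound[OF bA that] pos by (intro mult_left_mono) auto
      then show "diameter (foldr \<phi> u ` A) \<le> prod_list (map \<rho> u) * D"
        using A(2) by (intro diameter_le) (auto simp: dist_norm)
      show "bounded (foldr \<phi> u ` A)"
        unfolding bounded_two_points using dA by auto
    qed
    have bound: "hausdorff_premeasure s \<delta> A \<le> ennreal (S ^ n * D powr s)" if n: "r ^ n * D \<le> \<delta>" for n
    proof -
      have "hausdorff_premeasure s \<delta> A \<le> (\<Sum>u\<in>words I n. ennreal (diam_pow s (foldr \<phi> u ` A)))"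
      proof (rule hausdorff_premeasure_le_finite_cover)
        show "A \<subseteq> (\<Union>u\<in>words I n. foldr \<phi> u ` A)"
          using attractor_eq_Union_words[OF A(3), of n] by simp
        show "bounded (foldr \<phi> u ` A) \<and> diameter (foldr \<phi> u ` A) \<le> \<delta>" if "u \<in> words I n" for u
          using diam[OF that] bdd[OF that] mult_right_mono[OF le[OF that] D] n by auto
      qed (use \<open>finite I\<close> \<open>\<delta> > 0\<close> in auto)
      also have "\<dots> \<le> (\<Sum>u\<in>words I n. ennreal (prod_list (map (\<lambda>i. \<rho> i powr s) u) * D powr s))"
      proof (intro sum_mono ennreal_leI)
        fix u assume u: "u \<in> words I n"
        have "diam_pow s (foldr \<phi> u ` A) = diameter (foldr \<phi> u ` A) powr s"
          using A(2) s by (simp add: diam_pow_def)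
        also have "\<dots> \<le> (prod_list (map \<rho> u) * D) powr s"
          using diam[OF u] diameter_ge_0[OF bdd[OF u]] s by (intro powr_mono2) auto
        also have "\<dots> = prod_list (map \<rho> u) powr s * D powr s"
          using pos[OF u] D by (simp add: powr_mult)
        also have "prod_list (map \<rho> u) powr s = prod_list (map (\<lambda>i. \<rho> i powr s) u)"
          using u \<rho> by (intro prod_list_map_powr) (auto simp: words_def less_imp_le subset_eq)
        finally show "diam_pow s (foldr \<phi> u ` A) \<le> prod_list (map (\<lambda>i. \<rho> i powr s) u) * D powr s" .
      qed
      also have "\<dots> = ennreal (\<Sum>u\<in>words I n. prod_list (map (\<lambda>i. \<rho> i powr s) u) * D powr s)"
        by (intro sum_ennreal) (auto intro!: mult_nonneg_nonneg prod_list_nonneg)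
      also have "(\<Sum>u\<in>words I n. prod_list (map (\<lambda>i. \<rho> i powr s) u) * D powr s) = S ^ n * D powr s"
        by (simp add: sum_distrib_right[symmetric] sum_words_prod_list S_def)
      finally show ?thesis .
    qed
    have "(\<lambda>n. r ^ n * D) \<longlonglongrightarrow> 0"
      using r by (auto intro!: tendsto_eq_intros LIMSEQ_power_zero)
    then have "\<forall>\<^sub>F n in sequentially. r ^ n * D < \<delta>"
      using \<open>\<delta> > 0\<close> by (rule order_tendstoD)
    then have ev: "\<forall>\<^sub>F n in sequentially. hausdorff_premeasure s \<delta> A \<le> ennreal (S ^ n * D powr s)"
      by eventually_elim (auto intro: bound)
    have "(\<lambda>n. S ^ n * D powr s) \<longlonglongrightarrow> 0"
      using S by (auto intro!: tendsto_eq_intros LIMSEQ_power_zero)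
    then have "(\<lambda>n. ennreal (S ^ n * D powr s)) \<longlonglongrightarrow> ennreal 0"
      by (rule tendsto_ennrealI)
    then have "hausdorff_premeasure s \<delta> A \<le> ennreal 0"
      using ev by (intro tendsto_lowerbound) auto
    then show ?thesis by simp
  qed
  then show ?thesis
    unfolding hausdorff_outer_measure_def by (simp add: SUP_eq_iff)
qed

text \<open>
  Some s > d carries positive measure, so \<Sum>i. \<rho>_i^s \<ge> 1. This sum is strictly decreasing
  in s, which makes it larger than 1 at the midpoint of d and s.
\<close>
lemma exists_exponent_of_hausdorff_dim_gt:
  fixes A :: "'a::euclidean_space set"
  assumes "finite I" and A: "compact A" "A \<noteq> {}" "A = (\<Union>i\<in>I. \<phi> i ` A)"
    and sim: "\<And>i x y. i \<in> I \<Longrightarrow> dist (\<phi> i x) (\<phi> i y) = \<rho> i * dist x y"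
    and \<rho>: "\<And>i. i \<in> I \<Longrightarrow> 0 < \<rho> i \<and> \<rho> i \<le> r" and r: "0 < r" "r < 1"
    and d: "0 \<le> d" "hausdorff_dim A > ennreal d"
  obtains t where "d < t" "1 < (\<Sum>i\<in>I. \<rho> i powr t)"
proof -
  have "\<exists>s>d. hausdorff_outer_measure s A \<noteq> 0"
  proof (rule ccontr)
    assume "\<not> ?thesis"
    then have zero: "hausdorff_outer_measure s A = 0" if "s > d" for s using that by auto
    have "hausdorff_dim A \<le> ennreal d"
    proof (rule ennreal_le_epsilon)
      fix e :: real assume "0 < e"
      have "hausdorff_dim A \<le> ennreal (d + e)"
        unfolding hausdorff_dim_def using zero[of "d + e"] \<open>0 < e\<close> d(1) by (intro Inf_lower imageI) auto
      then show "hausdorff_dim A \<le> ennreal d + ennreal e"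
        using \<open>0 < e\<close> d(1) by (simp add: ennreal_plus)
    qed
    with d(2) show False by simp
  qed
  then obtain s where s: "s > d" "hausdorff_outer_measure s A \<noteq> 0" by auto
  have ge: "1 \<le> (\<Sum>i\<in>I. \<rho> i powr s)"
    using hausdorff_outer_measure_attractor_eq_0[of I A \<phi> \<rho> r s] assms s by force
  have "I \<noteq> {}" using A by auto
  have "(\<Sum>i\<in>I. \<rho> i powr s) < (\<Sum>i\<in>I. \<rho> i powr ((d + s) / 2))"
    using \<open>finite I\<close> \<open>I \<noteq> {}\<close> \<rho> r s(1)
    by (intro sum_strict_mono powr_less_mono') (auto, fastforce)
  with ge have "1 < (\<Sum>i\<in>I. \<rho> i powr ((d + s) / 2))" by simp
  with s(1) show thesis by (intro that[of "(d + s) / 2"]) auto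
qed

section \<open>A self-similar distribution function on the interval\<close>

lemma finite_positive_lower_bound:
  fixes d :: "'i \<Rightarrow> real"
  assumes "finite W" "\<And>w. w \<in> W \<Longrightarrow> 0 < d w"
  shows "\<exists>\<delta>>0. \<forall>w\<in>W. \<delta> \<le> d w"
  using assms by (intro exI[of _ "Min (insert 1 (d ` W))"]) auto

lemma inj_continuous_separates_point:
  fixes f :: "real \<Rightarrow> real"
  assumes "continuous_on {0..1} f" "inj_on f {0..1}" "compact S" "S \<subseteq> {0..1}" "a \<in> {0..1}" "a \<notin> S"
  shows "\<exists>\<eta>>0. \<forall>s\<in>S. \<eta> \<le> \<bar>f s - f a\<bar>"
proof -
  have "closed (f ` S)"
    using assms by (intro compact_imp_closed compact_continuous_image continuous_on_subset[OF assms(1)])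
  moreover have "f a \<notin> f ` S"
    using inj_on_image_mem_iff[OF assms(2,5,4)] assms(6) by simp
  ultimately obtain \<eta> where "\<eta> > 0" "\<And>y. y \<in> f ` S \<Longrightarrow> \<eta> \<le> dist (f a) y"
    using separate_point_closed[of "f ` S" "f a"] by auto
  then show ?thesis
    by (intro exI[of _ \<eta>]) (auto simp: dist_real_def abs_minus_commute)
qed

text \<open>
  The one-dimensional model: injective maps of the unit interval into its interior, with
  nonoverlapping images and probability weights. The distribution function cdf of the
  associated self-similar measure is built directly from its functional equation. The maps
  may reverse the orientation, in which case a reflected copy of cdf is inserted.
\<close>
locale interval_ifs =
  fixes W :: "'i set" and \<psi> :: "'i \<Rightarrow> real \<Rightarrow> real" and p :: "'i \<Rightarrow> real"
  assumes finite_W: "finite W"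
    and cont: "\<And>w. w \<in> W \<Longrightarrow> continuous_on {0..1} (\<psi> w)"
    and inj: "\<And>w. w \<in> W \<Longrightarrow> inj_on (\<psi> w) {0..1}"
    and inner: "\<And>w. w \<in> W \<Longrightarrow> \<psi> w ` {0..1} \<subseteq> {0<..<1}"
    and overlap: "\<And>v w x y. \<lbrakk>v \<in> W; w \<in> W; v \<noteq> w; x \<in> \<psi> v ` {0..1} \<inter> \<psi> w ` {0..1};
        y \<in> \<psi> v ` {0..1} \<inter> \<psi> w ` {0..1}\<rbrakk> \<Longrightarrow> x = y"
    and p: "\<And>w. w \<in> W \<Longrightarrow> 0 \<le> p w \<and> p w < 1"
    and sum_p: "sum p W = 1"
begin

definition lo :: "'i \<Rightarrow> real" where "lo w = min (\<psi> w 0) (\<psi> w 1)"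
definition hi :: "'i \<Rightarrow> real" where "hi w = max (\<psi> w 0) (\<psi> w 1)"

lemma image_eq: "w \<in> W \<Longrightarrow> \<psi> w ` {0..1} = {lo w..hi w}"
  using continuous_injective_image_segment_1[of 0 1 "\<psi> w"] cont[of w] inj[of w]
  by (auto simp: closed_segment_eq_real_ivl lo_def hi_def min_def max_def split: if_splits)

lemma lo_less_hi: "w \<in> W \<Longrightarrow> lo w < hi w"
  using inj_on_eq_iff[OF inj[of w], of 0 1] by (auto simp: lo_def hi_def)

lemma lo_hi_inner: "w \<in> W \<Longrightarrow> 0 < lo w \<and> hi w < 1"
  using inner[of w] by (auto simp: lo_def hi_def image_subset_iff)

lemma separated:
  assumes "v \<in> W" "w \<in> W" "v \<noteq> w"
  shows "hi v \<le> lo w \<or> hi w \<le> lo v"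
proof (rule ccontr)
  assume "\<not> ?thesis"
  then have "max (lo v) (lo w) = min (hi v) (hi w)"
    using assms lo_less_hi[of v] lo_less_hi[of w]
    by (intro overlap[of v w]) (auto simp: image_eq)
  with \<open>\<not> ?thesis\<close> show False
    using lo_less_hi[OF assms(1)] lo_less_hi[OF assms(2)] by linarith
qed

text \<open>
  The distribution function of the image, under the map with index w, of the measure whose
  distribution function is F. When the map is decreasing, this measure is reflected.
\<close>
definition piece :: "(real \<Rightarrow> real) \<Rightarrow> 'i \<Rightarrow> real \<Rightarrow> real" where
  "piece F w t = (if t \<le> lo w then 0 else if hi w \<le> t then 1
     else if \<psi> w 0 < \<psi> w 1 then F (inv_into {0..1} (\<psi> w) t)
     else 1 - F (inv_into {0..1} (\<psi> w) t))"

definition transfer :: "(real \<Rightarrow> real) \<Rightarrow> real \<Rightarrow> real" where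
  "transfer F t = (\<Sum>w\<in>W. p w * piece F w t)"

definition approx :: "nat \<Rightarrow> real \<Rightarrow> real" where
  "approx n = (transfer ^^ n) (\<lambda>_. 0)"

definition cdf :: "real \<Rightarrow> real" where
  "cdf t = lim (\<lambda>n. approx n t)"

lemma piece_bounds: "(\<And>t. F t \<in> {0..1}) \<Longrightarrow> piece F w t \<in> {0..1}"
  by (auto simp: piece_def)

lemma transfer_bounds:
  assumes "\<And>t. F t \<in> {0..1}"
  shows "transfer F t \<in> {0..1}"
proof -
  have "(\<Sum>w\<in>W. p w * piece F w t) \<le> (\<Sum>w\<in>W. p w * 1)"
    using piece_bounds[OF assms] p by (intro sum_mono mult_left_mono) auto
  moreover have "0 \<le> (\<Sum>w\<in>W. p w * piece F w t)"
    using piece_bounds[OF assms] p by (intro sum_nonneg mult_nonneg_nonneg) auto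
  ultimately show ?thesis by (simp add: transfer_def sum_p)
qed

lemma approx_bounds: "approx n t \<in> {0..1}"
proof (induction n arbitrary: t)
  case (Suc n)
  have "approx (Suc n) t = transfer (approx n) t" by (simp add: approx_def)
  then show ?case using transfer_bounds[OF Suc] by simp
qed (simp add: approx_def)

text \<open>
  At each t at most one index has t inside its interval, and only this index sees F. So the
  contraction factor is the largest single weight, not the sum of the weights.
\<close>
lemma transfer_contracts:
  assumes "\<And>t. \<bar>F t - G t\<bar> \<le> e" and q: "\<And>w. w \<in> W \<Longrightarrow> p w \<le> q" "0 \<le> q"
  shows "\<bar>transfer F t - transfer G t\<bar> \<le> q * e"
proof -
  have e: "0 \<le> e" using assms(1)[of 0] by linarith
  have piece_diff: "\<bar>piece F w t - piece G w t\<bar> \<le> e" for w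
    using assms(1)[of "inv_into {0..1} (\<psi> w) t"] e by (auto simp: piece_def)
  show ?thesis
  proof (cases "\<exists>w\<in>W. lo w < t \<and> t < hi w")
    case True
    then obtain w where w: "w \<in> W" "lo w < t" "t < hi w" by auto
    have other: "piece F v t = piece G v t" if "v \<in> W - {w}" for v
      using separated[of v w] that w by (auto simp: piece_def)
    have "transfer F t - transfer G t = p w * (piece F w t - piece G w t)"
      unfolding transfer_def using w(1) finite_W other
      by (simp add: sum.remove[of W w] right_diff_distrib)
    also have "\<bar>\<dots>\<bar> \<le> q * e"
      unfolding abs_mult using p[OF w(1)] q(1)[OF w(1)] q(2) piece_diff[of w] by (intro mult_mono) auto
    finally show ?thesis .
  next
    case False
    then have "piece F w t = piece G w t" if "w \<in> W" for w
      using that by (force simp: piece_def)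
    then have "transfer F t = transfer G t" by (simp add: transfer_def)
    then show ?thesis using e q by simp
  qed
qed

text \<open>
  The transfer operator contracts the supremum distance by the largest weight q < 1, so the
  increments of the iterates are dominated by a geometric series.
\<close>
lemma approx_tendsto_cdf: "(\<lambda>n. approx n t) \<longlonglongrightarrow> cdf t"
proof -
  define q where "q = Max (insert 0 (p ` W))"
  have q: "0 \<le> q" "q < 1" "\<And>w. w \<in> W \<Longrightarrow> p w \<le> q"
    using finite_W p by (auto simp: q_def)
  have diff: "\<bar>approx (Suc n) t - approx n t\<bar> \<le> q ^ n" for n t
  proof (induction n arbitrary: t)
    case 0
    show ?case using approx_bounds[of "Suc 0" t] by (simp add: approx_def)
  next
    case (Suc n)
    have "\<bar>transfer (approx (Suc n)) t - transfer (approx n) t\<bar> \<le> q * q ^ n"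
      by (rule transfer_contracts[OF Suc q(3,1)])
    then show ?case by (simp add: approx_def)
  qed
  have "summable (\<lambda>n. q ^ n)" using q by (intro summable_geometric) auto
  then have "summable (\<lambda>n. approx (Suc n) t - approx n t)"
    by (rule summable_comparison_test'[where N = 0]) (use diff in \<open>simp only: real_norm_def\<close>)
  then have "convergent (\<lambda>n. \<Sum>k<n. approx (Suc k) t - approx k t)"
    by (simp add: summable_iff_convergent)
  then have "convergent (\<lambda>n. approx n t)"
    by (simp only: sum_lessThan_telescope[of "\<lambda>n. approx n t"]) (simp add: approx_def)
  then show ?thesis unfolding cdf_def by (simp add: convergent_LIMSEQ_iff)
qed

lemma cdf_bounds: "cdf t \<in> {0..1}"
  by (rule closed_sequentially[OF closed_real_atLeastAtMost _ approx_tendsto_cdf]) (rule approx_bounds)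

lemma cdf_fixed_point: "cdf t = transfer cdf t"
proof (rule LIMSEQ_unique)
  show "(\<lambda>n. approx (Suc n) t) \<longlonglongrightarrow> cdf t"
    using approx_tendsto_cdf by (rule LIMSEQ_Suc)
  have "(\<lambda>n. piece (approx n) w t) \<longlonglongrightarrow> piece cdf w t" for w
    unfolding piece_def by (auto intro!: tendsto_intros approx_tendsto_cdf)
  then show "(\<lambda>n. approx (Suc n) t) \<longlonglongrightarrow> transfer cdf t"
    unfolding approx_def funpow.simps comp_def
    unfolding approx_def[symmetric] transfer_def by (intro tendsto_intros)
qed

lemma cdf_left: "(\<And>w. w \<in> W \<Longrightarrow> t \<le> lo w) \<Longrightarrow> cdf t = 0"
  by (subst cdf_fixed_point) (simp add: transfer_def piece_def)

lemma cdf_right: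
  assumes "\<And>w. w \<in> W \<Longrightarrow> hi w \<le> t"
  shows "cdf t = 1"
proof -
  have "piece cdf w t = 1" if "w \<in> W" for w
    using assms[OF that] lo_less_hi[OF that] by (simp add: piece_def)
  then show ?thesis by (subst cdf_fixed_point) (simp add: transfer_def sum_p)
qed

lemma cdf_0: "cdf 0 = 0"
  using lo_hi_inner by (intro cdf_left) (auto intro: less_imp_le)

lemma cdf_1: "cdf 1 = 1"
  using lo_hi_inner by (intro cdf_right) (auto intro: less_imp_le)

text \<open>
  At the two ends of the interval of w the values prescribed by the first two branches of
  piece agree with the third one, because cdf is 0 at 0 and 1 at 1.
\<close>
lemma piece_cdf:
  assumes "w \<in> W" "t \<in> {0..1}"
  shows "piece cdf w (\<psi> w t) = (if \<psi> w 0 < \<psi> w 1 then cdf t else 1 - cdf t)"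
proof -
  have inv: "inv_into {0..1} (\<psi> w) (\<psi> w t) = t"
    using inj assms by (intro inv_into_f_f)
  have mem: "\<psi> w t \<in> {lo w..hi w}"
    using image_eq assms by blast
  have eq: "\<psi> w t = \<psi> w s \<longleftrightarrow> t = s" if "s \<in> {0..1}" for s
    using inj_on_eq_iff[OF inj[OF assms(1)] assms(2) that] .
  consider "t = 0" | "t = 1" | "\<psi> w t \<noteq> \<psi> w 0" "\<psi> w t \<noteq> \<psi> w 1"
    using eq[of 0] eq[of 1] by auto
  then show ?thesis
  proof cases
    case 3
    then have "lo w < \<psi> w t" "\<psi> w t < hi w"
      using mem by (auto simp: lo_def hi_def min_def max_def split: if_splits)
    then show ?thesis by (simp add: piece_def inv)
  qed (use eq[of 0] eq[of 1] in \<open>auto simp: piece_def lo_def hi_def cdf_0 cdf_1\<close>)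
qed

lemma cdf_self_similar:
  assumes w: "w \<in> W" and st: "s \<in> {0..1}" "t \<in> {0..1}"
  shows "\<bar>cdf (\<psi> w s) - cdf (\<psi> w t)\<bar> = p w * \<bar>cdf s - cdf t\<bar>"
proof -
  have in_w: "\<psi> w x \<in> {lo w..hi w}" if "x \<in> {0..1}" for x
    using image_eq[OF w] that by blast
  have other: "piece cdf v (\<psi> w s) = piece cdf v (\<psi> w t)" if "v \<in> W - {w}" for v
    using separated[of v w] that w in_w[OF st(1)] in_w[OF st(2)] lo_less_hi[of v]
    by (auto simp: piece_def)
  have "cdf (\<psi> w s) - cdf (\<psi> w t) = transfer cdf (\<psi> w s) - transfer cdf (\<psi> w t)"
    by (simp flip: cdf_fixed_point)
  also have "\<dots> = p w * (piece cdf w (\<psi> w s) - piece cdf w (\<psi> w t))"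
    unfolding transfer_def using w finite_W other
    by (simp add: sum.remove[of W w] right_diff_distrib)
  also have "\<bar>\<dots>\<bar> = p w * \<bar>cdf s - cdf t\<bar>"
    using p[OF w] unfolding piece_cdf[OF w st(1)] piece_cdf[OF w st(2)]
    by (simp add: abs_mult abs_minus_commute)
  finally show ?thesis .
qed

text \<open>
  All images lie in the open interval, so cdf is constant near 0 and near 1. Transported by the
  map of w, this makes the contribution of w constant slightly beyond the ends of its interval
  on the inner side. This is the property for which the images are required to avoid 0 and 1.
\<close>
lemma piece_cdf_plateau:
  assumes w: "w \<in> W"
  shows "\<exists>\<eta>>0. (\<forall>t<lo w + \<eta>. piece cdf w t = 0) \<and> (\<forall>t>hi w - \<eta>. piece cdf w t = 1)"
proof -
  have "\<exists>\<epsilon>>0. \<forall>v\<in>W. \<epsilon> \<le> min (lo v) (1 - hi v)"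
    using lo_hi_inner by (intro finite_positive_lower_bound finite_W) auto
  then obtain \<epsilon> where \<epsilon>: "0 < \<epsilon>" "\<And>v. v \<in> W \<Longrightarrow> \<epsilon> \<le> lo v \<and> hi v \<le> 1 - \<epsilon>"
    by force
  have plateau_0: "cdf s = 0" if "s \<le> \<epsilon>" for s
    using \<epsilon>(2) that by (intro cdf_left) (auto intro: order_trans)
  have plateau_1: "cdf s = 1" if "1 - \<epsilon> \<le> s" for s
    using \<epsilon>(2) that by (intro cdf_right) (auto intro: order_trans)
  obtain \<eta>0 where \<eta>0: "\<eta>0 > 0" "\<And>s. s \<in> {\<epsilon>..1} \<Longrightarrow> \<eta>0 \<le> \<bar>\<psi> w s - \<psi> w 0\<bar>"
    using inj_continuous_separates_point[OF cont[OF w] inj[OF w], of "{\<epsilon>..1}" 0] \<epsilon>(1) by auto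
  obtain \<eta>1 where \<eta>1: "\<eta>1 > 0" "\<And>s. s \<in> {0..1 - \<epsilon>} \<Longrightarrow> \<eta>1 \<le> \<bar>\<psi> w s - \<psi> w 1\<bar>"
    using inj_continuous_separates_point[OF cont[OF w] inj[OF w], of "{0..1 - \<epsilon>}" 1] \<epsilon>(1) by auto
  define \<eta> where "\<eta> = Min {\<eta>0, \<eta>1, hi w - lo w}"
  have \<eta>: "\<eta> > 0" "\<eta> \<le> \<eta>0" "\<eta> \<le> \<eta>1" "\<eta> \<le> hi w - lo w"
    using \<eta>0 \<eta>1 lo_less_hi[OF w] by (auto simp: \<eta>_def)
  have "piece cdf w t = 0" if t: "t < lo w + \<eta>" for t
  proof (cases "t \<le> lo w")
    case False
    then have "t \<in> \<psi> w ` {0..1}" using t \<eta> by (simp add: image_eq[OF w])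
    then obtain s where s: "s \<in> {0..1}" "t = \<psi> w s" by auto
    show ?thesis
    proof (cases "\<psi> w 0 < \<psi> w 1")
      case True
      then have "\<bar>\<psi> w s - \<psi> w 0\<bar> < \<eta>0" using False t s \<eta> by (auto simp: lo_def)
      then have "s < \<epsilon>" using \<eta>0(2)[of s] s by force
      then show ?thesis using piece_cdf[OF w s(1)] True s(2) plateau_0[of s] by simp
    next
      case F: False
      then have "\<bar>\<psi> w s - \<psi> w 1\<bar> < \<eta>1" using False t s \<eta> by (auto simp: lo_def min_def split: if_splits)
      then have "1 - \<epsilon> < s" using \<eta>1(2)[of s] s by force
      then show ?thesis using piece_cdf[OF w s(1)] F s(2) plateau_1[of s] by simp
    qed
  qed (simp add: piece_def)
  moreover have "piece cdf w t = 1" if t: "t > hi w - \<eta>" for t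
  proof (cases "hi w \<le> t")
    case False
    then have "t \<in> \<psi> w ` {0..1}" using t \<eta> by (simp add: image_eq[OF w])
    then obtain s where s: "s \<in> {0..1}" "t = \<psi> w s" by auto
    show ?thesis
    proof (cases "\<psi> w 0 < \<psi> w 1")
      case True
      then have "\<bar>\<psi> w s - \<psi> w 1\<bar> < \<eta>1" using False t s \<eta> by (auto simp: hi_def)
      then have "1 - \<epsilon> < s" using \<eta>1(2)[of s] s by force
      then show ?thesis using piece_cdf[OF w s(1)] True s(2) plateau_1[of s] by simp
    next
      case F: False
      then have "\<bar>\<psi> w s - \<psi> w 0\<bar> < \<eta>0" using False t s \<eta> by (auto simp: hi_def max_def split: if_splits)
      then have "s < \<epsilon>" using \<eta>0(2)[of s] s by force
      then show ?thesis using piece_cdf[OF w s(1)] F s(2) plateau_0[of s] by simp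
    qed
  qed (use lo_less_hi[OF w] in \<open>simp add: piece_def\<close>)
  ultimately show ?thesis using \<eta>(1) by blast
qed

text \<open>
  If cdf distinguishes s and t, the contribution of some w does. As that contribution is
  constant outside the interval of w and on a fixed inner margin of it, two nearby points
  can only be distinguished when both lie in this interval.
\<close>
lemma cdf_locally_constant_between_pieces:
  obtains \<delta> where "0 < \<delta>"
    "\<And>s t. \<lbrakk>\<bar>s - t\<bar> < \<delta>; cdf s \<noteq> cdf t\<rbrakk> \<Longrightarrow> \<exists>w\<in>W. s \<in> \<psi> w ` {0..1} \<and> t \<in> \<psi> w ` {0..1}"
proof -
  have "\<forall>w\<in>W. \<exists>\<eta>>0. (\<forall>t<lo w + \<eta>. piece cdf w t = 0) \<and> (\<forall>t>hi w - \<eta>. piece cdf w t = 1)"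
    by (intro ballI piece_cdf_plateau)
  then obtain d where "\<forall>w\<in>W. 0 < d w
      \<and> (\<forall>t<lo w + d w. piece cdf w t = 0) \<and> (\<forall>t>hi w - d w. piece cdf w t = 1)"
    by (rule bchoice[THEN exE])
  then have d: "0 < d w" "\<And>t. t < lo w + d w \<Longrightarrow> piece cdf w t = 0"
    "\<And>t. t > hi w - d w \<Longrightarrow> piece cdf w t = 1" if "w \<in> W" for w
    using that by blast+
  obtain \<eta> where \<eta>: "0 < \<eta>" "\<And>w. w \<in> W \<Longrightarrow> \<eta> \<le> d w"
    using finite_positive_lower_bound[of W d] finite_W d(1) by auto
  have ordered: "\<exists>w\<in>W. s \<in> \<psi> w ` {0..1} \<and> t \<in> \<psi> w ` {0..1}"
    if st: "s \<le> t" "t < s + \<eta>" "cdf s \<noteq> cdf t" for s t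
  proof -
    have "\<exists>w\<in>W. piece cdf w s \<noteq> piece cdf w t"
    proof (rule ccontr)
      assume "\<not> ?thesis"
      then have "transfer cdf s = transfer cdf t" by (simp add: transfer_def)
      then show False using st(3) by (simp flip: cdf_fixed_point)
    qed
    then obtain w where w: "w \<in> W" "piece cdf w s \<noteq> piece cdf w t" by auto
    note plat = d(2)[OF w(1)] d(3)[OF w(1)] \<eta>(2)[OF w(1)]
    have "lo w \<le> s"
    proof (rule ccontr)
      assume "\<not> lo w \<le> s"
      then have "s < lo w + d w" "t < lo w + d w" using st \<eta>(1) plat(3) by linarith+
      then show False using plat(1) w(2) by simp
    qed
    moreover have "t \<le> hi w"
    proof (rule ccontr)
      assume "\<not> t \<le> hi w"
      then have "s > hi w - d w" "t > hi w - d w" using st \<eta>(1) plat(3) by linarith+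
      then show False using plat(2) w(2) by simp
    qed
    ultimately show ?thesis using w(1) st(1) image_eq[OF w(1)] by (intro bexI[of _ w]) auto
  qed
  show thesis
  proof (rule that[OF \<eta>(1)])
    fix s t :: real
    assume "\<bar>s - t\<bar> < \<eta>" "cdf s \<noteq> cdf t"
    then show "\<exists>w\<in>W. s \<in> \<psi> w ` {0..1} \<and> t \<in> \<psi> w ` {0..1}"
      using ordered[of s t] ordered[of t s] by (cases "s \<le> t") auto
  qed
qed

end

section \<open>Extension of superlinear Hoelder functions by weighted averages\<close>

text \<open>
  Termwise differentiation, in gradient form: the derivatives converge uniformly on U by the
  Weierstrass test.
\<close>
lemma gderiv_series:
  fixes a :: "nat \<Rightarrow> 'a::euclidean_space \<Rightarrow> real" and g :: "nat \<Rightarrow> 'a \<Rightarrow> 'a"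
  assumes U: "open U" "convex U"
    and deriv: "\<And>n x. x \<in> U \<Longrightarrow> GDERIV (a n) x :> g n x"
    and a: "\<And>n x. x \<in> U \<Longrightarrow> \<bar>a n x\<bar> \<le> M n"
    and g: "\<And>n x. x \<in> U \<Longrightarrow> norm (g n x) \<le> L n"
    and sM: "summable M" and sL: "summable L" and x: "x \<in> U"
  shows "GDERIV (\<lambda>x. \<Sum>n. a n x) x :> (\<Sum>n. g n x)"
proof -
  have unif: "uniform_limit U (\<lambda>n x. \<Sum>i<n. g i x) (\<lambda>x. \<Sum>i. g i x) sequentially"
    by (rule Weierstrass_m_test[OF g sL])
  have small: "\<forall>\<^sub>F n in sequentially. \<forall>x\<in>U. \<forall>h.
      norm ((\<Sum>i<n. h \<bullet> g i x) - h \<bullet> (\<Sum>i. g i x)) \<le> e * norm h" if "e > 0" for e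
    using uniform_limitD[OF unif that]
  proof eventually_elim
    case (elim n)
    show ?case
    proof (intro ballI allI)
      fix x h assume "x \<in> U"
      have "(\<Sum>i<n. h \<bullet> g i x) - h \<bullet> (\<Sum>i. g i x) = h \<bullet> ((\<Sum>i<n. g i x) - (\<Sum>i. g i x))"
        by (simp add: inner_diff_right inner_sum_right)
      also have "norm \<dots> \<le> norm h * norm ((\<Sum>i<n. g i x) - (\<Sum>i. g i x))"
        by (simp add: Cauchy_Schwarz_ineq2)
      also have "\<dots> \<le> norm h * e"
        using elim \<open>x \<in> U\<close> by (intro mult_left_mono) (auto simp: dist_norm less_imp_le)
      finally show "norm ((\<Sum>i<n. h \<bullet> g i x) - h \<bullet> (\<Sum>i. g i x)) \<le> e * norm h"
        by (simp add: mult.commute)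
    qed
  qed
  have "summable (\<lambda>n. a n x)"
    by (rule summable_comparison_test'[OF sM, of 0]) (use a x in auto)
  then have sums: "(\<lambda>n. a n x) sums (\<Sum>n. a n x)" by (rule summable_sums)
  have "\<exists>G. \<forall>x\<in>U. (\<lambda>n. a n x) sums G x \<and> (G has_derivative (\<lambda>h. h \<bullet> (\<Sum>i. g i x))) (at x within U)"
  proof (rule has_derivative_series[where f' = "\<lambda>n x h. h \<bullet> g n x"])
    show "(a n has_derivative (\<lambda>h. h \<bullet> g n x)) (at x within U)" if "x \<in> U" for n x
      using deriv[OF that] unfolding gderiv_def by (rule has_derivative_at_withinI)
  qed (fact U(2) small x sums)+
  then obtain G where G: "\<And>x. x \<in> U \<Longrightarrow> (\<lambda>n. a n x) sums G x"
    "\<And>x. x \<in> U \<Longrightarrow> (G has_derivative (\<lambda>h. h \<bullet> (\<Sum>i. g i x))) (at x within U)" by blast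
  have "((\<lambda>x. \<Sum>n. a n x) has_derivative (\<lambda>h. h \<bullet> (\<Sum>i. g i x))) (at x within U)"
    by (rule has_derivative_transform[OF x _ G(2)[OF x]]) (use G(1) in \<open>simp add: sums_iff\<close>)
  then show ?thesis
    unfolding gderiv_def using at_within_open[OF x U(1)] by simp
qed

lemma continuous_on_series:
  fixes g :: "nat \<Rightarrow> 'a::topological_space \<Rightarrow> 'b::banach"
  assumes "\<And>n. continuous_on U (g n)" "\<And>n x. x \<in> U \<Longrightarrow> norm (g n x) \<le> M n" "summable M"
  shows "continuous_on U (\<lambda>x. \<Sum>n. g n x)"
  by (rule uniform_limit_theorem[OF _ Weierstrass_m_test[OF assms(2,3)]])
    (auto intro!: always_eventually continuous_on_sum assms(1))

text \<open>
  The even power makes the kernel a rational function of the coordinates, hence smooth away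
  from 0.
\<close>
definition riesz :: "nat \<Rightarrow> 'a::real_inner \<Rightarrow> real" where
  "riesz m z = inverse (norm z ^ (2 * m))"

definition riesz_grad :: "nat \<Rightarrow> 'a::real_inner \<Rightarrow> 'a" where
  "riesz_grad m z = - (2 * real m * inverse (norm z ^ (2 * m + 2))) *\<^sub>R z"

lemma riesz_pos: "z \<noteq> 0 \<Longrightarrow> 0 < riesz m z"
  by (simp add: riesz_def)

lemma riesz_powr: "z \<noteq> 0 \<Longrightarrow> riesz m z = norm z powr (- (2 * real m))"
  by (simp add: riesz_def powr_minus flip: powr_realpow)

lemma norm_riesz_grad: "z \<noteq> 0 \<Longrightarrow> norm (riesz_grad m z) = 2 * real m / norm z * riesz m z"
  by (simp add: riesz_grad_def riesz_def power_add power2_eq_square field_simps)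

lemma riesz_antimono: "0 < \<eta> \<Longrightarrow> \<eta> \<le> norm z \<Longrightarrow> riesz m z \<le> inverse (\<eta> ^ (2 * m))"
  unfolding riesz_def by (intro le_imp_inverse_le power_mono) auto

lemma gderiv_riesz:
  assumes "x \<noteq> y"
  shows "GDERIV (\<lambda>x. riesz m (x - y)) x :> riesz_grad m (x - y)"
proof -
  have sq: "norm z ^ (2 * m) = (z \<bullet> z) ^ m" for z :: 'a and m
    by (simp add: power_mult power2_norm_eq_inner)
  have pos: "(x - y) \<bullet> (x - y) > 0" using assms by simp
  have 1: "GDERIV (\<lambda>x. (x - y) \<bullet> (x - y)) x :> 2 *\<^sub>R (x - y)"
    unfolding gderiv_def
    by (auto intro!: derivative_eq_intros simp: inner_commute inner_diff_right)
  have 2: "DERIV (\<lambda>u. inverse (u ^ m)) u :> - (real m * inverse (u ^ Suc m))" if "u > 0" for u :: real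
  proof (cases m)
    case (Suc k)
    have "DERIV (\<lambda>u. inverse (u ^ m)) u :> - (inverse (u ^ m) * (real m * u ^ k) * inverse (u ^ m))"
      using DERIV_inverse'[OF DERIV_pow[of m u]] that Suc by simp
    also have "- (inverse (u ^ m) * (real m * u ^ k) * inverse (u ^ m)) = - (real m * inverse (u ^ Suc m))"
      using that Suc by (simp add: field_simps)
    finally show ?thesis .
  qed simp
  have "GDERIV (\<lambda>x. inverse (((x - y) \<bullet> (x - y)) ^ m)) x :>
      (- (real m * inverse (((x - y) \<bullet> (x - y)) ^ Suc m))) *\<^sub>R (2 *\<^sub>R (x - y))"
    by (rule GDERIV_DERIV_compose[OF 1 2[OF pos]])
  moreover have "norm (x - y) ^ (2 * m + 2) = ((x - y) \<bullet> (x - y)) ^ Suc m"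
    using sq[of "x - y" "Suc m"] by simp
  ultimately show ?thesis
    unfolding riesz_def riesz_grad_def sq by (simp add: mult_ac)
qed

lemma continuous_on_riesz_grad: "continuous_on (- {0}) (riesz_grad m)"
  unfolding riesz_grad_def by (intro continuous_intros) auto

text \<open>
  The nets N n, with at most B^n points and mesh r q^n, express that the upper box dimension of
  K is finite. The last assumption on m says that the exponent \<tau> below exceeds 1.
\<close>
locale netted_holder_function =
  fixes K :: "'a::euclidean_space set" and f :: "'a \<Rightarrow> real" and C t :: real
    and N :: "nat \<Rightarrow> 'a set" and B :: nat and r q :: real and m :: nat
  assumes compact_K: "compact K" and K_nonempty: "K \<noteq> {}"
    and C: "0 \<le> C" and t: "1 < t"
    and holder: "\<And>x y. x \<in> K \<Longrightarrow> y \<in> K \<Longrightarrow> \<bar>f x - f y\<bar> \<le> C * dist x y powr t"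
    and finite_N: "\<And>n. finite (N n)" and N_sub: "\<And>n. N n \<subseteq> K"
    and B: "1 \<le> B" and card_N: "\<And>n. card (N n) \<le> B ^ n"
    and r: "0 < r" and q: "0 < q" "q < 1"
    and net: "\<And>n x. x \<in> K \<Longrightarrow> \<exists>y\<in>N n. dist x y \<le> r * q ^ n"
    and m_ge: "t \<le> 2 * real m"
    and m_large: "1 < t * (1 - ln (1 / (2 * real B)) / ln q / (2 * real m))"
begin

text \<open>
  The factor c is chosen so that c^n times the size of the n-th net is at most 2^(-n). A point
  of a net whose mesh is comparable to \<delta> then carries a weight of order \<delta>^D.
\<close>
definition c :: real where "c = 1 / (2 * real B)"
definition D :: real where "D = ln c / ln q"
definition \<kappa> :: real where "\<kappa> = 1 - D / (2 * real m)"
definition \<tau> :: real where "\<tau> = t * \<kappa>"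

text \<open>
  The weighted sum of g over all nets; wgrad is its termwise gradient and mass the total
  weight, so that wsum f / mass is the average that defines the extension.
\<close>
definition wsum :: "('a \<Rightarrow> real) \<Rightarrow> 'a \<Rightarrow> real" where
  "wsum g x = (\<Sum>n. c ^ n * (\<Sum>y\<in>N n. g y * riesz m (x - y)))"

definition wgrad :: "('a \<Rightarrow> real) \<Rightarrow> 'a \<Rightarrow> 'a" where
  "wgrad g x = (\<Sum>n. c ^ n *\<^sub>R (\<Sum>y\<in>N n. g y *\<^sub>R riesz_grad m (x - y)))"

definition mass :: "'a \<Rightarrow> real" where
  "mass = wsum (\<lambda>_. 1)"

definition bdd_on_K :: "('a \<Rightarrow> real) \<Rightarrow> bool" where
  "bdd_on_K g \<longleftrightarrow> (\<exists>G\<ge>0. \<forall>y\<in>K. \<bar>g y\<bar> \<le> G)"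

lemma c_pos: "0 < c" using B by (simp add: c_def)
lemma c_less_1: "c < 1" using B by (simp add: c_def)
lemma D_pos: "0 < D" unfolding D_def using c_pos c_less_1 q by (intro divide_neg_neg) auto
lemma m_pos: "0 < real m" using m_ge t by linarith
lemma \<tau>_gt_1: "1 < \<tau>" using m_large by (simp add: \<tau>_def \<kappa>_def D_def c_def)
lemma \<tau>_le_t: "\<tau> \<le> t"
  unfolding \<tau>_def \<kappa>_def using D_pos m_pos t by (intro mult_left_le) auto

lemma c_power_card: "c ^ n * real (card (N n)) \<le> (1 / 2) ^ n"
proof -
  have "c ^ n * real (card (N n)) \<le> c ^ n * real B ^ n"
    using card_N[of n] c_pos by (intro mult_left_mono) (auto simp flip: of_nat_power)
  also have "\<dots> = (c * real B) ^ n" by (simp add: power_mult_distrib)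
  also have "c * real B = 1 / 2" using B by (simp add: c_def)
  finally show ?thesis .
qed

lemma bounded_series_term:
  fixes h :: "'a \<Rightarrow> 'b::real_normed_vector"
  assumes "\<And>y. y \<in> K \<Longrightarrow> norm (h y) \<le> H" "0 \<le> H"
  shows "norm (c ^ n *\<^sub>R (\<Sum>y\<in>N n. h y)) \<le> H * (1 / 2) ^ n"
proof -
  have "norm (\<Sum>y\<in>N n. h y) \<le> real (card (N n)) * H"
    using N_sub assms(1) by (intro sum_norm_bound) auto
  then have "norm (c ^ n *\<^sub>R (\<Sum>y\<in>N n. h y)) \<le> c ^ n * (real (card (N n)) * H)"
    using c_pos by (simp add: mult_left_mono)
  also have "\<dots> \<le> (1 / 2) ^ n * H"
    using mult_right_mono[OF c_power_card assms(2)] by (simp add: mult.assoc)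
  finally show ?thesis by (simp add: mult.commute)
qed

lemma summable_half: "summable (\<lambda>n. H * (1 / 2) ^ n :: real)"
  by (intro summable_mult summable_geometric) auto

lemma term_bound:
  assumes "0 < \<eta>" "\<And>y. y \<in> K \<Longrightarrow> \<eta> \<le> dist x y" "\<And>y. y \<in> K \<Longrightarrow> \<bar>g y\<bar> \<le> G" "0 \<le> G"
  shows "\<bar>c ^ n * (\<Sum>y\<in>N n. g y * riesz m (x - y))\<bar> \<le> G * inverse (\<eta> ^ (2 * m)) * (1 / 2) ^ n"
    and "norm (c ^ n *\<^sub>R (\<Sum>y\<in>N n. g y *\<^sub>R riesz_grad m (x - y)))
      \<le> G * (2 * real m / \<eta> * inverse (\<eta> ^ (2 * m))) * (1 / 2) ^ n"
proof -
  have ne: "x - y \<noteq> 0" and \<eta>: "\<eta> \<le> norm (x - y)" if "y \<in> K" for y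
    using assms(1) assms(2)[OF that] by (auto simp: dist_norm)
  have le: "\<bar>riesz m (x - y)\<bar> \<le> inverse (\<eta> ^ (2 * m))" if "y \<in> K" for y
    using riesz_antimono[OF assms(1) \<eta>[OF that], of m] riesz_pos[OF ne[OF that], of m] by simp
  have "norm (c ^ n *\<^sub>R (\<Sum>y\<in>N n. g y * riesz m (x - y))) \<le> G * inverse (\<eta> ^ (2 * m)) * (1 / 2) ^ n"
    using assms(1,3,4) le by (intro bounded_series_term) (auto simp: abs_mult intro!: mult_mono)
  then show "\<bar>c ^ n * (\<Sum>y\<in>N n. g y * riesz m (x - y))\<bar> \<le> G * inverse (\<eta> ^ (2 * m)) * (1 / 2) ^ n"
    by simp
  have grad_le: "norm (riesz_grad m (x - y)) \<le> 2 * real m / \<eta> * inverse (\<eta> ^ (2 * m))" if "y \<in> K" for y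
    unfolding norm_riesz_grad[OF ne[OF that]]
    using le[OF that] riesz_pos[OF ne[OF that], of m] \<eta>[OF that] assms(1)
    by (intro mult_mono divide_left_mono) (auto intro: mult_pos_pos order.strict_trans2)
  show "norm (c ^ n *\<^sub>R (\<Sum>y\<in>N n. g y *\<^sub>R riesz_grad m (x - y)))
      \<le> G * (2 * real m / \<eta> * inverse (\<eta> ^ (2 * m))) * (1 / 2) ^ n"
  proof (rule bounded_series_term[where h = "\<lambda>y. g y *\<^sub>R riesz_grad m (x - y)"])
    show "norm (g y *\<^sub>R riesz_grad m (x - y)) \<le> G * (2 * real m / \<eta> * inverse (\<eta> ^ (2 * m)))"
      if "y \<in> K" for y
      unfolding norm_scaleR using assms(3)[OF that] assms(4) grad_le[OF that] by (intro mult_mono) auto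
  qed (use assms(1,4) in auto)
qed

lemma off_K:
  assumes "x \<notin> K"
  obtains \<eta> where "0 < \<eta>" "\<And>y. y \<in> K \<Longrightarrow> \<eta> \<le> dist x y"
  using separate_point_closed[of K x] compact_imp_closed[OF compact_K] assms by blast

lemma summable_wsum:
  assumes "x \<notin> K" "bdd_on_K g"
  shows "summable (\<lambda>n. c ^ n * (\<Sum>y\<in>N n. g y * riesz m (x - y)))"
proof -
  obtain \<eta> where \<eta>: "0 < \<eta>" "\<And>y. y \<in> K \<Longrightarrow> \<eta> \<le> dist x y" using off_K[OF assms(1)] by blast
  obtain G where G: "0 \<le> G" "\<And>y. y \<in> K \<Longrightarrow> \<bar>g y\<bar> \<le> G" using assms(2) by (auto simp: bdd_on_K_def)
  show ?thesis
    by (rule summable_comparison_test'[OF summable_half, of 0])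
      (use term_bound(1)[OF \<eta> G(2,1)] in simp)
qed

lemma summable_wgrad:
  assumes "x \<notin> K" "bdd_on_K g"
  shows "summable (\<lambda>n. norm (c ^ n *\<^sub>R (\<Sum>y\<in>N n. g y *\<^sub>R riesz_grad m (x - y))))"
proof -
  obtain \<eta> where \<eta>: "0 < \<eta>" "\<And>y. y \<in> K \<Longrightarrow> \<eta> \<le> dist x y" using off_K[OF assms(1)] by blast
  obtain G where G: "0 \<le> G" "\<And>y. y \<in> K \<Longrightarrow> \<bar>g y\<bar> \<le> G" using assms(2) by (auto simp: bdd_on_K_def)
  show ?thesis
    by (rule summable_comparison_test'[OF summable_half, of 0])
      (simp only: real_norm_def abs_norm_cancel, rule term_bound(2)[OF \<eta> G(2,1)])
qed

lemma wsum_differentiable: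
  assumes "x \<notin> K" "bdd_on_K g"
  shows "GDERIV (wsum g) x :> wgrad g x" and "isCont (wgrad g) x"
proof -
  obtain \<eta> where \<eta>: "0 < \<eta>" "\<And>y. y \<in> K \<Longrightarrow> \<eta> \<le> dist x y" using off_K[OF assms(1)] by blast
  obtain G where G: "0 \<le> G" "\<And>y. y \<in> K \<Longrightarrow> \<bar>g y\<bar> \<le> G" using assms(2) by (auto simp: bdd_on_K_def)
  define U where "U = ball x (\<eta> / 2)"
  have far: "\<eta> / 2 \<le> dist z y" if "z \<in> U" "y \<in> K" for z y
    using \<eta>(2)[OF that(2)] that(1) dist_triangle[of x y z] by (simp add: U_def)
  have \<eta>2: "0 < \<eta> / 2" using \<eta>(1) by simp
  have U: "open U" "convex U" "x \<in> U" using \<eta>(1) by (auto simp: U_def)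
  have ne: "z \<noteq> y" if "z \<in> U" "y \<in> N n" for z y n
    using far[OF that(1), of y] N_sub[of n] that(2) \<eta>(1) by force
  have deriv: "GDERIV (\<lambda>x. c ^ n * (\<Sum>y\<in>N n. g y * riesz m (x - y))) z :>
      c ^ n *\<^sub>R (\<Sum>y\<in>N n. g y *\<^sub>R riesz_grad m (z - y))" if "z \<in> U" for n z
    unfolding gderiv_def
    by (auto intro!: derivative_eq_intros gderiv_riesz[OF ne[OF that], unfolded gderiv_def]
        simp: inner_sum_right)
  show "GDERIV (wsum g) x :> wgrad g x"
    unfolding wsum_def[abs_def] wgrad_def
    by (rule gderiv_series[OF U(1,2) deriv term_bound(1)[OF \<eta>2 far G(2,1)]
          term_bound(2)[OF \<eta>2 far G(2,1)] summable_half summable_half U(3)])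
  have "continuous_on U (wgrad g)"
    unfolding wgrad_def[abs_def]
  proof (rule continuous_on_series[OF _ term_bound(2)[OF \<eta>2 far G(2,1)] summable_half])
    fix n
    show "continuous_on U (\<lambda>x. c ^ n *\<^sub>R (\<Sum>y\<in>N n. g y *\<^sub>R riesz_grad m (x - y)))"
      using ne by (intro continuous_intros continuous_on_compose2[OF continuous_on_riesz_grad]) auto
  qed
  then show "isCont (wgrad g) x"
    using U by (simp add: continuous_on_eq_continuous_at)
qed

lemma bdd_on_K_intros:
  "bdd_on_K (\<lambda>_. b)"
  "bdd_on_K g \<Longrightarrow> bdd_on_K (\<lambda>y. g y - b)"
  "bdd_on_K g \<Longrightarrow> bdd_on_K (\<lambda>y. \<bar>g y\<bar>)"
  "bdd_on_K f"
proof -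
  show "bdd_on_K (\<lambda>_. b)" unfolding bdd_on_K_def by (intro exI[of _ "\<bar>b\<bar>"]) auto
  show "bdd_on_K (\<lambda>y. \<bar>g y\<bar>)" if "bdd_on_K g" using that by (simp add: bdd_on_K_def)
  show "bdd_on_K (\<lambda>y. g y - b)" if g: "bdd_on_K g"
  proof -
    obtain G where "G \<ge> 0" "\<forall>y\<in>K. \<bar>g y\<bar> \<le> G" using g by (auto simp: bdd_on_K_def)
    then show ?thesis unfolding bdd_on_K_def by (intro exI[of _ "G + \<bar>b\<bar>"]) force
  qed
  obtain v where v: "v \<in> K" using K_nonempty by auto
  have "\<bar>f y\<bar> \<le> \<bar>f v\<bar> + C * diameter K powr t" if "y \<in> K" for y
  proof -
    have "\<bar>f y - f v\<bar> \<le> C * dist y v powr t" using holder that v by blast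
    also have "\<dots> \<le> C * diameter K powr t"
      using diameter_bounded_bound[OF compact_imp_bounded[OF compact_K] that v] C t
      by (intro mult_left_mono powr_mono2) auto
    finally show ?thesis by linarith
  qed
  then show "bdd_on_K f"
    unfolding bdd_on_K_def using C by (intro exI[of _ "\<bar>f v\<bar> + C * diameter K powr t"]) auto
qed

lemma wsum_mono:
  assumes "x \<notin> K" "bdd_on_K g" "bdd_on_K h" "\<And>y. y \<in> K \<Longrightarrow> g y \<le> h y"
  shows "wsum g x \<le> wsum h x"
  unfolding wsum_def
proof (rule suminf_le[OF _ summable_wsum summable_wsum])
  fix n
  have "riesz m (x - y) > 0" if "y \<in> K" for y
    using that assms(1) by (intro riesz_pos) auto
  then show "c ^ n * (\<Sum>y\<in>N n. g y * riesz m (x - y)) \<le> c ^ n * (\<Sum>y\<in>N n. h y * riesz m (x - y))"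
    using c_pos N_sub[of n] assms(4) by (intro mult_left_mono sum_mono mult_right_mono) (auto intro: less_imp_le)
qed (use assms in auto)

lemma wsum_minus_const:
  assumes "x \<notin> K" "bdd_on_K g"
  shows "wsum (\<lambda>y. g y - b) x = wsum g x - b * mass x"
proof -
  have "c ^ n * (\<Sum>y\<in>N n. (g y - b) * riesz m (x - y))
      = c ^ n * (\<Sum>y\<in>N n. g y * riesz m (x - y)) - b * (c ^ n * (\<Sum>y\<in>N n. 1 * riesz m (x - y)))" for n
    by (simp add: left_diff_distrib right_diff_distrib sum_subtractf sum_distrib_left mult_ac)
  then show ?thesis
    unfolding wsum_def mass_def
    using summable_wsum[OF assms] summable_wsum[OF assms(1) bdd_on_K_intros(1)[of 1]]
    by (simp only: suminf_diff[symmetric] suminf_mult summable_mult)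
qed

lemma wgrad_minus_const:
  assumes "x \<notin> K" "bdd_on_K g"
  shows "wgrad (\<lambda>y. g y - b) x = wgrad g x - b *\<^sub>R wgrad (\<lambda>_. 1) x"
proof -
  have "c ^ n *\<^sub>R (\<Sum>y\<in>N n. (g y - b) *\<^sub>R riesz_grad m (x - y))
      = c ^ n *\<^sub>R (\<Sum>y\<in>N n. g y *\<^sub>R riesz_grad m (x - y))
        - b *\<^sub>R (c ^ n *\<^sub>R (\<Sum>y\<in>N n. 1 *\<^sub>R riesz_grad m (x - y)))" for n
    by (simp add: scaleR_left_diff_distrib scaleR_right_diff_distrib sum_subtractf scaleR_sum_right mult_ac)
  then show ?thesis
    unfolding wgrad_def
    using summable_norm_cancel[OF summable_wgrad[OF assms]]
      summable_norm_cancel[OF summable_wgrad[OF assms(1) bdd_on_K_intros(1)[of 1]]]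
    by (simp only: suminf_diff[symmetric] suminf_scaleR_right summable_scaleR_right)
qed

lemma wsum_abs:
  assumes "x \<notin> K" "bdd_on_K g"
  shows "\<bar>wsum g x\<bar> \<le> wsum (\<lambda>y. \<bar>g y\<bar>) x"
proof -
  have "wsum g x \<le> wsum (\<lambda>y. \<bar>g y\<bar>) x"
    using assms by (intro wsum_mono bdd_on_K_intros) auto
  moreover have "wsum (\<lambda>y. - g y) x \<le> wsum (\<lambda>y. \<bar>g y\<bar>) x"
    using assms by (intro wsum_mono bdd_on_K_intros) (auto simp: bdd_on_K_def)
  moreover have "wsum (\<lambda>y. - g y) x = - wsum g x"
    unfolding wsum_def using suminf_minus[OF summable_wsum[OF assms]] by (simp add: sum_negf)
  ultimately show ?thesis by linarith
qed

text \<open>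
  Differentiating the kernel costs a factor 2 m / |x - y|, and no point of K is closer to x
  than \<delta>.
\<close>
lemma norm_wgrad_le:
  assumes "x \<notin> K" "bdd_on_K g" and \<delta>: "0 < \<delta>" "\<And>y. y \<in> K \<Longrightarrow> \<delta> \<le> dist x y"
  shows "norm (wgrad g x) \<le> 2 * real m / \<delta> * wsum (\<lambda>y. \<bar>g y\<bar>) x"
proof -
  have ne: "x - y \<noteq> 0" and \<delta>_le: "\<delta> \<le> norm (x - y)" if "y \<in> K" for y
    using \<delta>(1) \<delta>(2)[OF that] by (auto simp: dist_norm)
  have "norm (wgrad g x) \<le> (\<Sum>n. norm (c ^ n *\<^sub>R (\<Sum>y\<in>N n. g y *\<^sub>R riesz_grad m (x - y))))"
    unfolding wgrad_def by (rule summable_norm[OF summable_wgrad[OF assms(1,2)]])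
  also have "\<dots> \<le> (\<Sum>n. 2 * real m / \<delta> * (c ^ n * (\<Sum>y\<in>N n. \<bar>g y\<bar> * riesz m (x - y))))"
  proof (rule suminf_le[OF _ summable_wgrad summable_mult[OF summable_wsum]])
    fix n
    have "norm (\<Sum>y\<in>N n. g y *\<^sub>R riesz_grad m (x - y)) \<le> (\<Sum>y\<in>N n. 2 * real m / \<delta> * (\<bar>g y\<bar> * riesz m (x - y)))"
    proof (rule sum_norm_le)
      fix y assume "y \<in> N n"
      then have y: "y \<in> K" using N_sub by auto
      have "2 * real m / norm (x - y) \<le> 2 * real m / \<delta>"
        using \<delta>_le[OF y] \<delta>(1) by (intro divide_left_mono) (auto intro: mult_pos_pos order.strict_trans2)
      then have "2 * real m / norm (x - y) * (\<bar>g y\<bar> * riesz m (x - y)) \<le> 2 * real m / \<delta> * (\<bar>g y\<bar> * riesz m (x - y))"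
        using riesz_pos[OF ne[OF y], of m] by (intro mult_right_mono) auto
      then show "norm (g y *\<^sub>R riesz_grad m (x - y)) \<le> 2 * real m / \<delta> * (\<bar>g y\<bar> * riesz m (x - y))"
        by (simp add: norm_riesz_grad[OF ne[OF y]] mult_ac)
    qed
    then have "norm (\<Sum>y\<in>N n. g y *\<^sub>R riesz_grad m (x - y))
        \<le> 2 * real m / \<delta> * (\<Sum>y\<in>N n. \<bar>g y\<bar> * riesz m (x - y))"
      by (simp only: sum_distrib_left)
    then have "c ^ n * norm (\<Sum>y\<in>N n. g y *\<^sub>R riesz_grad m (x - y))
        \<le> c ^ n * (2 * real m / \<delta> * (\<Sum>y\<in>N n. \<bar>g y\<bar> * riesz m (x - y)))"
      using c_pos by (intro mult_left_mono) auto
    then show "norm (c ^ n *\<^sub>R (\<Sum>y\<in>N n. g y *\<^sub>R riesz_grad m (x - y)))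
        \<le> 2 * real m / \<delta> * (c ^ n * (\<Sum>y\<in>N n. \<bar>g y\<bar> * riesz m (x - y)))"
      using c_pos by (simp add: mult_ac)
  qed (use assms in \<open>auto intro: bdd_on_K_intros\<close>)
  also have "\<dots> = 2 * real m / \<delta> * wsum (\<lambda>y. \<bar>g y\<bar>) x"
    unfolding wsum_def using assms by (intro suminf_mult summable_wsum bdd_on_K_intros)
  finally show ?thesis .
qed

text \<open>
  The constant c1 comes from the single net point used in mass_lower_bound, and E collects the
  constants of oscillation_bound.
\<close>
definition c1 :: real where "c1 = c * (1 + r) powr (- (2 * real m))"
definition E :: real where "E = C * 2 powr t * (1 + 2 / c1)"

lemma c1_pos: "0 < c1"
  using c_pos r by (simp add: c1_def)

lemma E_nonneg: "0 \<le> E"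
  using C c1_pos by (simp add: E_def)

text \<open>
  One term suffices: at the first level n with q^n \<le> \<delta> there is a net point at distance at
  most (1 + r) \<delta> from x, and its weight c^n is at least c \<delta>^D.
\<close>
lemma mass_lower_bound:
  assumes x: "x \<notin> K" and v: "v \<in> K" "dist x v = \<delta>" "\<delta> < 1"
  shows "c1 * \<delta> powr (- (2 * real m * \<kappa>)) \<le> mass x"
proof -
  have \<delta>: "0 < \<delta>" using x v by auto
  define n where "n = nat \<lceil>ln \<delta> / ln q\<rceil>"
  have quot: "0 < ln \<delta> / ln q" using \<delta> v(3) q by (intro divide_neg_neg) auto
  have n: "ln \<delta> / ln q \<le> real n" "real n \<le> ln \<delta> / ln q + 1"
    using quot by (auto simp: n_def)
  have lnq: "ln q < 0" using q by simp
  have "real n * ln q \<le> ln \<delta>"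
    using n(1) lnq by (simp add: neg_divide_le_eq)
  then have "exp (real n * ln q) \<le> exp (ln \<delta>)" by simp
  then have q_le: "q ^ n \<le> \<delta>"
    using q \<delta> by (simp add: exp_of_nat_mult)
  have "(ln \<delta> / ln q + 1) * ln c \<le> real n * ln c"
    using n(2) c_pos c_less_1 by (intro mult_right_mono_neg) auto
  moreover have "(ln \<delta> / ln q + 1) * ln c = ln c + D * ln \<delta>"
    by (simp add: D_def field_simps)
  ultimately have "exp (ln c + D * ln \<delta>) \<le> exp (real n * ln c)" by simp
  then have c_ge: "c * \<delta> powr D \<le> c ^ n"
    using c_pos \<delta> by (simp add: exp_of_nat_mult exp_add powr_def)
  obtain y where y: "y \<in> N n" "dist v y \<le> r * q ^ n" using net[OF v(1)] by blast
  have yK: "y \<in> K" using y(1) N_sub by auto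
  have ne: "x - y \<noteq> 0" using x yK by auto
  have "norm (x - y) \<le> \<delta> + r * q ^ n"
    using dist_triangle[of x y v] y(2) v(2) by (simp add: dist_norm)
  also have "\<dots> \<le> (1 + r) * \<delta>"
    using q_le r by (simp add: algebra_simps)
  finally have "((1 + r) * \<delta>) powr (- (2 * real m)) \<le> riesz m (x - y)"
    unfolding riesz_powr[OF ne] using ne by (intro powr_mono2') auto
  then have riesz_ge: "(1 + r) powr (- (2 * real m)) * \<delta> powr (- (2 * real m)) \<le> riesz m (x - y)"
    using r \<delta> by (simp add: powr_mult)
  have term_nonneg: "0 \<le> c ^ k * (\<Sum>y\<in>N k. 1 * riesz m (x - y))" for k
    using c_pos by (intro mult_nonneg_nonneg sum_nonneg) (auto simp: riesz_def)
  have "c1 * \<delta> powr (- (2 * real m * \<kappa>)) = c * \<delta> powr D * ((1 + r) powr (- (2 * real m)) * \<delta> powr (- (2 * real m)))"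
    using m_pos \<delta> by (simp add: c1_def \<kappa>_def algebra_simps flip: powr_add)
  also have "\<dots> \<le> c ^ n * riesz m (x - y)"
    using c_ge riesz_ge c_pos by (intro mult_mono) auto
  also have "\<dots> \<le> c ^ n * (\<Sum>y\<in>N n. 1 * riesz m (x - y))"
    using y(1) finite_N c_pos
    by (auto intro!: mult_left_mono member_le_sum simp: riesz_def)
  also have "\<dots> = (\<Sum>k\<in>{n}. c ^ k * (\<Sum>y\<in>N k. 1 * riesz m (x - y)))" by simp
  also have "\<dots> \<le> mass x"
    unfolding mass_def wsum_def
    using term_nonneg by (intro sum_le_suminf summable_wsum x bdd_on_K_intros) auto
  finally show ?thesis .
qed

lemma mass_pos: "x \<notin> K \<Longrightarrow> 0 < mass x"
proof -
  assume x: "x \<notin> K"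
  obtain v where v: "v \<in> K" using K_nonempty by auto
  obtain y where y: "y \<in> N 0" using net[OF v, of 0] by auto
  have term_nonneg: "0 \<le> c ^ k * (\<Sum>y\<in>N k. 1 * riesz m (x - y))" for k
    using c_pos by (intro mult_nonneg_nonneg sum_nonneg) (auto simp: riesz_def)
  have "0 < riesz m (x - y)" using x y N_sub by (intro riesz_pos) auto
  then have "0 < c ^ 0 * (\<Sum>y\<in>N 0. 1 * riesz m (x - y))"
    using y finite_N by (auto intro!: sum_pos2 simp: riesz_def)
  then show "0 < mass x"
    unfolding mass_def wsum_def
    using term_nonneg by (intro suminf_pos2[of _ 0] summable_wsum x bdd_on_K_intros) auto
qed

text \<open>
  The values f y at points within distance l = \<delta>^\<kappa> of x differ from f v by O(l^t), and their
  share of the total mass is at most 1. The points farther away contribute at most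
  O(l^(t - 2m)) altogether, and \<kappa> is chosen so that l^(-2m) is exactly the order of
  the lower bound for the mass. Both parts are thus O(l^t) = O(\<delta>^\<tau>) times the mass.
\<close>
lemma oscillation_bound:
  assumes x: "x \<notin> K" and v: "v \<in> K" "dist x v = \<delta>" "\<delta> < 1" and near: "\<And>y. y \<in> K \<Longrightarrow> \<delta> \<le> dist x y"
  shows "wsum (\<lambda>y. \<bar>f y - f v\<bar>) x \<le> E * \<delta> powr \<tau> * mass x"
proof -
  have \<delta>: "0 < \<delta>" using x v by auto
  (* the radius that separates near points from far points *)
  define l where "l = \<delta> powr \<kappa>"
  have l: "0 < l" using \<delta> by (simp add: l_def)
  have l_t: "l powr t = \<delta> powr \<tau>" by (simp add: l_def \<tau>_def powr_powr mult.commute)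
  have pointwise: "\<bar>f y - f v\<bar> * riesz m (x - y)
      \<le> C * 2 powr t * (l powr t * riesz m (x - y) + l powr (t - 2 * real m))" if y: "y \<in> K" for y
  proof -
    define R where "R = norm (x - y)"
    have R: "\<delta> \<le> R" "0 < R" using near[OF y] \<delta> by (auto simp: R_def dist_norm)
    have ne: "x - y \<noteq> 0" using R(2) by (auto simp: R_def)
    have riesz_R: "riesz m (x - y) = R powr (- (2 * real m))" by (simp add: riesz_powr[OF ne] R_def)
    have "dist y v \<le> 2 * R"
      using dist_triangle[of y v x] v(2) R(1) by (simp add: R_def dist_norm norm_minus_commute)
    then have "\<bar>f y - f v\<bar> \<le> C * (2 * R) powr t"
      using holder[OF y v(1)] C t by (elim order_trans) (intro mult_left_mono powr_mono2, auto)
    then have "\<bar>f y - f v\<bar> * riesz m (x - y) \<le> C * (2 * R) powr t * riesz m (x - y)"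
      using riesz_pos[OF ne, of m] by (intro mult_right_mono) auto
    also have "\<dots> = C * 2 powr t * (R powr t * riesz m (x - y))"
      using R by (simp add: powr_mult)
    also have "R powr t * riesz m (x - y) \<le> l powr t * riesz m (x - y) + l powr (t - 2 * real m)"
    proof (cases "R \<le> l")
      case True
      then have "R powr t \<le> l powr t" using R t by (intro powr_mono2) auto
      then show ?thesis
        using riesz_pos[OF ne, of m] by (intro add_increasing2 mult_right_mono) auto
    next
      case False
      have "R powr t * riesz m (x - y) = R powr (t - 2 * real m)"
        unfolding riesz_R by (simp flip: powr_add)
      also have "\<dots> \<le> l powr (t - 2 * real m)"
        using False l m_ge by (intro powr_mono2') auto
      finally show ?thesis using riesz_pos[OF ne, of m] by (intro add_increasing) auto
    qed
    finally show ?thesis using C by (simp add: mult_left_mono)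
  qed
  have "wsum (\<lambda>y. \<bar>f y - f v\<bar>) x
      \<le> (\<Sum>n. C * 2 powr t * (l powr t * (c ^ n * (\<Sum>y\<in>N n. 1 * riesz m (x - y)))
           + l powr (t - 2 * real m) * (1 / 2) ^ n))"
    unfolding wsum_def
  proof (rule suminf_le)
    fix n
    have "(\<Sum>y\<in>N n. \<bar>f y - f v\<bar> * riesz m (x - y))
        \<le> (\<Sum>y\<in>N n. C * 2 powr t * (l powr t * riesz m (x - y) + l powr (t - 2 * real m)))"
      using N_sub[of n] by (intro sum_mono pointwise) auto
    also have "\<dots> = C * 2 powr t * (l powr t * (\<Sum>y\<in>N n. riesz m (x - y)) + l powr (t - 2 * real m) * card (N n))"
      by (simp add: sum.distrib sum_distrib_left[symmetric] mult.commute)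
    finally have "c ^ n * (\<Sum>y\<in>N n. \<bar>f y - f v\<bar> * riesz m (x - y))
        \<le> c ^ n * (C * 2 powr t * (l powr t * (\<Sum>y\<in>N n. riesz m (x - y)) + l powr (t - 2 * real m) * card (N n)))"
      using c_pos by (intro mult_left_mono) auto
    also have "\<dots> = C * 2 powr t * (l powr t * (c ^ n * (\<Sum>y\<in>N n. riesz m (x - y)))
        + l powr (t - 2 * real m) * (c ^ n * card (N n)))"
      by (simp add: algebra_simps)
    also have "\<dots> \<le> C * 2 powr t * (l powr t * (c ^ n * (\<Sum>y\<in>N n. riesz m (x - y)))
        + l powr (t - 2 * real m) * (1 / 2) ^ n)"
      using c_power_card[of n] C by (intro mult_left_mono add_left_mono) auto
    finally show "c ^ n * (\<Sum>y\<in>N n. \<bar>f y - f v\<bar> * riesz m (x - y))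
        \<le> C * 2 powr t * (l powr t * (c ^ n * (\<Sum>y\<in>N n. 1 * riesz m (x - y)))
           + l powr (t - 2 * real m) * (1 / 2) ^ n)" by simp
  qed (intro summable_wsum summable_mult summable_add summable_half x bdd_on_K_intros)+
  also have "\<dots> = C * 2 powr t * (l powr t * mass x + l powr (t - 2 * real m) * 2)"
  proof -
    have "(\<lambda>n. c ^ n * (\<Sum>y\<in>N n. 1 * riesz m (x - y))) sums mass x"
      unfolding mass_def wsum_def by (intro summable_sums summable_wsum x bdd_on_K_intros)
    moreover have "(\<lambda>n. (1 / 2 :: real) ^ n) sums 2"
      using geometric_sums[of "1 / 2 :: real"] by simp
    ultimately show ?thesis
      by (intro sums_unique[symmetric] sums_mult sums_add)
  qed
  also have "\<dots> \<le> C * 2 powr t * (l powr t * mass x + l powr t * (mass x / c1) * 2)"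
  proof -
    have "l powr (- (2 * real m)) = \<delta> powr (- (2 * real m * \<kappa>))"
      by (simp add: l_def powr_powr mult.commute)
    also have "\<dots> \<le> mass x / c1"
      using mass_lower_bound[OF x v] c1_pos by (simp add: pos_le_divide_eq mult.commute)
    finally have "l powr t * l powr (- (2 * real m)) \<le> l powr t * (mass x / c1)"
      by (intro mult_left_mono) auto
    then have "l powr (t - 2 * real m) \<le> l powr t * (mass x / c1)" by (simp flip: powr_add)
    then show ?thesis using C by (intro mult_left_mono add_left_mono mult_right_mono) auto
  qed
  also have "\<dots> = E * \<delta> powr \<tau> * mass x"
    by (simp add: l_t E_def algebra_simps)
  finally show ?thesis .
qed

definition extension :: "'a \<Rightarrow> real" where
  "extension x = (if x \<in> K then f x else wsum f x / mass x)"

definition extension_grad :: "'a \<Rightarrow> 'a" where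
  "extension_grad x = (if x \<in> K then 0
     else (1 / mass x) *\<^sub>R (wgrad f x - extension x *\<^sub>R wgrad (\<lambda>_. 1) x))"

lemma nearest_point:
  obtains v where "v \<in> K" "\<And>y. y \<in> K \<Longrightarrow> dist x v \<le> dist x y"
  using distance_attains_inf[of K x] compact_imp_closed[OF compact_K] K_nonempty by blast

lemma extension_near_nearest_point:
  assumes x: "x \<notin> K" and v: "v \<in> K" "dist x v = \<delta>" "\<delta> < 1" and near: "\<And>y. y \<in> K \<Longrightarrow> \<delta> \<le> dist x y"
  shows "\<bar>extension x - f v\<bar> \<le> E * \<delta> powr \<tau>"
proof -
  have "wsum f x - f v * mass x = wsum (\<lambda>y. f y - f v) x"
    using x by (simp add: wsum_minus_const bdd_on_K_intros)
  then have "\<bar>wsum f x - f v * mass x\<bar> \<le> E * \<delta> powr \<tau> * mass x"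
    using wsum_abs[OF x bdd_on_K_intros(2)[OF bdd_on_K_intros(4)], of "f v"]
      oscillation_bound[OF x v near] by linarith
  moreover have "extension x - f v = (wsum f x - f v * mass x) / mass x"
    using x mass_pos[OF x] by (simp add: extension_def field_simps)
  ultimately show ?thesis
    using mass_pos[OF x] by (simp add: pos_divide_le_eq)
qed

text \<open>
  The gradient of the quotient is the gradient sum of f - F x, where F x is frozen, divided by
  the mass; the kernel gradient costs 1 / \<delta> and f - F x averages to O(\<delta>^\<tau>).
\<close>
lemma norm_extension_grad_le:
  assumes x: "x \<notin> K" and v: "v \<in> K" "dist x v = \<delta>" "\<delta> < 1" and near: "\<And>y. y \<in> K \<Longrightarrow> \<delta> \<le> dist x y"
  shows "norm (extension_grad x) \<le> 4 * real m * E * \<delta> powr (\<tau> - 1)"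
proof -
  have \<delta>: "0 < \<delta>" using x v by auto
  note bdd = bdd_on_K_intros
  have "norm (wgrad f x - extension x *\<^sub>R wgrad (\<lambda>_. 1) x) = norm (wgrad (\<lambda>y. f y - extension x) x)"
    using x by (simp add: wgrad_minus_const bdd)
  also have "\<dots> \<le> 2 * real m / \<delta> * wsum (\<lambda>y. \<bar>f y - extension x\<bar>) x"
    by (rule norm_wgrad_le[OF x _ \<delta> near]) (simp_all add: bdd)
  also have "\<dots> \<le> 2 * real m / \<delta> * (2 * E * \<delta> powr \<tau> * mass x)"
  proof (intro mult_left_mono)
    (* the sum is written as a difference so that wsum_minus_const applies *)
    have "wsum (\<lambda>y. \<bar>f y - extension x\<bar>) x \<le> wsum (\<lambda>y. \<bar>f y - f v\<bar> - (- \<bar>extension x - f v\<bar>)) x"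
      by (rule wsum_mono[OF x bdd(3)[OF bdd(2)[OF bdd(4)]] bdd(2)[OF bdd(3)[OF bdd(2)[OF bdd(4)]]]]) auto
    also have "\<dots> = wsum (\<lambda>y. \<bar>f y - f v\<bar>) x + \<bar>extension x - f v\<bar> * mass x"
      by (subst wsum_minus_const[OF x bdd(3)[OF bdd(2)[OF bdd(4)]]]) simp
    also have "\<dots> \<le> E * \<delta> powr \<tau> * mass x + E * \<delta> powr \<tau> * mass x"
      using mass_pos[OF x]
      by (intro add_mono oscillation_bound[OF x v near] mult_right_mono extension_near_nearest_point[OF x v near]) auto
    finally show "wsum (\<lambda>y. \<bar>f y - extension x\<bar>) x \<le> 2 * E * \<delta> powr \<tau> * mass x" by (simp add: mult_ac)
  qed (use \<delta> in auto)
  also have "\<dots> = 4 * real m * E * \<delta> powr (\<tau> - 1) * mass x"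
    using \<delta> by (simp add: powr_diff)
  finally show ?thesis
    using x mass_pos[OF x] by (simp add: extension_grad_def pos_divide_le_eq)
qed

text \<open>
  Passing from the nearest point v to an arbitrary z in K is harmless, because v is at distance
  at most 2 |x - z| from z.
\<close>
lemma extension_holder_at_K:
  assumes z: "z \<in> K" and x: "dist x z < 1"
  shows "\<bar>extension x - extension z\<bar> \<le> (E + C * 2 powr t) * dist x z powr \<tau>"
    and "norm (extension_grad x) \<le> 4 * real m * E * dist x z powr (\<tau> - 1)"
proof -
  have powr_le: "dist x z powr t \<le> dist x z powr \<tau>"
    using x \<tau>_le_t by (cases "x = z") (auto intro!: powr_mono')
  have "\<bar>extension x - extension z\<bar> \<le> (E + C * 2 powr t) * dist x z powr \<tau> \<and>
    norm (extension_grad x) \<le> 4 * real m * E * dist x z powr (\<tau> - 1)"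
  proof (cases "x \<in> K")
    case True
    have "\<bar>extension x - extension z\<bar> \<le> C * dist x z powr t"
      using True z holder by (simp add: extension_def)
    also have "\<dots> \<le> C * (2 powr t * dist x z powr \<tau>)"
      using powr_le C t by (intro mult_left_mono) (auto intro: order_trans[OF _ mult_right_mono[of 1]] simp: ge_one_powr_ge_zero)
    also have "\<dots> \<le> (E + C * 2 powr t) * dist x z powr \<tau>"
      using E_nonneg by (simp add: algebra_simps)
    finally show ?thesis
      using True E_nonneg by (simp add: extension_grad_def)
  next
    case False
    obtain v where v: "v \<in> K" "\<And>y. y \<in> K \<Longrightarrow> dist x v \<le> dist x y" using nearest_point by blast
    have v1: "dist x v < 1" using v(2)[OF z] x by simp
    have "dist v z \<le> 2 * dist x z"
      using dist_triangle[of v z x] v(2)[OF z] by (simp add: dist_commute)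
    then have "\<bar>f v - f z\<bar> \<le> C * (2 * dist x z) powr t"
      using holder[OF v(1) z] C t by (elim order_trans) (intro mult_left_mono powr_mono2, auto)
    also have "\<dots> = C * 2 powr t * dist x z powr t" by (simp add: powr_mult)
    also have "\<dots> \<le> C * 2 powr t * dist x z powr \<tau>" using powr_le C by (intro mult_left_mono) auto
    finally have 1: "\<bar>f v - f z\<bar> \<le> C * 2 powr t * dist x z powr \<tau>" .
    have 2: "\<bar>extension x - f v\<bar> \<le> E * dist x v powr \<tau>"
      by (rule extension_near_nearest_point[OF False v(1) refl v1 v(2)])
    also have "\<dots> \<le> E * dist x z powr \<tau>"
      using v(2)[OF z] E_nonneg \<tau>_gt_1 by (intro mult_left_mono powr_mono2) auto
    finally have 3: "\<bar>extension x - f v\<bar> \<le> E * dist x z powr \<tau>" .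
    have "norm (extension_grad x) \<le> 4 * real m * E * dist x v powr (\<tau> - 1)"
      by (rule norm_extension_grad_le[OF False v(1) refl v1 v(2)])
    also have "\<dots> \<le> 4 * real m * E * dist x z powr (\<tau> - 1)"
      using v(2)[OF z] E_nonneg \<tau>_gt_1 by (intro mult_left_mono powr_mono2) auto
    finally have 4: "norm (extension_grad x) \<le> 4 * real m * E * dist x z powr (\<tau> - 1)" .
    have "extension z = f z" using z by (simp add: extension_def)
    then have "\<bar>extension x - extension z\<bar> \<le> \<bar>extension x - f v\<bar> + \<bar>f v - f z\<bar>" by linarith
    with 1 3 4 show ?thesis by (simp add: distrib_right)
  qed
  then show "\<bar>extension x - extension z\<bar> \<le> (E + C * 2 powr t) * dist x z powr \<tau>"
    "norm (extension_grad x) \<le> 4 * real m * E * dist x z powr (\<tau> - 1)" by auto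
qed

lemma dist_powr_tendsto_0:
  assumes "0 < a"
  shows "((\<lambda>x. b * dist x z powr a) \<longlongrightarrow> 0) (at z)"
proof -
  have "((\<lambda>x. dist x z powr a) \<longlongrightarrow> 0) (at z)"
    using assms by (intro tendsto_zero_powrI[where b = a]) (auto intro!: tendsto_eq_intros)
  then show ?thesis by (rule tendsto_mult_right_zero)
qed

lemma eventually_near: "\<forall>\<^sub>F x in at z. dist x z < (1::real)"
  unfolding eventually_at by (intro exI[of _ 1]) auto

lemma gderiv_extension: "GDERIV extension x :> extension_grad x"
proof (cases "x \<in> K")
  case True
  have "((\<lambda>y. norm (extension y - extension x - 0) / norm (y - x)) \<longlongrightarrow> 0) (at x)"
  proof (rule tendsto_sandwich[OF _ _ tendsto_const dist_powr_tendsto_0])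
    show "\<forall>\<^sub>F y in at x. norm (extension y - extension x - 0) / norm (y - x)
        \<le> (E + C * 2 powr t) * dist y x powr (\<tau> - 1)"
      using eventually_near eventually_neq_at_within[of x x UNIV]
    proof eventually_elim
      case (elim y)
      then show ?case
        using extension_holder_at_K(1)[OF True elim(1)]
        by (simp add: pos_divide_le_eq powr_diff dist_norm)
    qed
    show "0 < \<tau> - 1" using \<tau>_gt_1 by simp
  qed auto
  then have "(extension has_derivative (\<lambda>h. 0)) (at x)"
    unfolding has_derivative_iff_norm by auto
  then show ?thesis using True by (simp add: gderiv_def extension_grad_def)
next
  case False
  have "GDERIV (\<lambda>x. wsum f x / mass x) x :> extension_grad x"
  proof -
    have m0: "wsum (\<lambda>_. 1) x \<noteq> 0" using mass_pos[OF False] by (simp add: mass_def)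
    have "GDERIV (\<lambda>x. wsum f x * inverse (mass x)) x :>
        wsum f x *\<^sub>R (- (inverse (mass x))\<^sup>2 *\<^sub>R wgrad (\<lambda>_. 1) x) + inverse (mass x) *\<^sub>R wgrad f x"
      unfolding mass_def
      by (intro GDERIV_mult GDERIV_inverse wsum_differentiable False bdd_on_K_intros m0)
    then show ?thesis
      using False by (simp add: divide_inverse extension_grad_def extension_def scaleR_diff_right power2_eq_square mult_ac)
  qed
  then have D: "((\<lambda>x. wsum f x / mass x) has_derivative (\<lambda>h. h \<bullet> extension_grad x)) (at x)"
    by (simp add: gderiv_def)
  show ?thesis
    unfolding gderiv_def
    by (rule has_derivative_transform_within_open[OF D, of "- K"])
      (use False compact_imp_closed[OF compact_K] in \<open>auto simp: extension_def\<close>)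
qed

lemma continuous_on_extension_grad: "continuous_on UNIV extension_grad"
proof -
  have "isCont extension_grad x" for x
  proof (cases "x \<in> K")
    case True
    have "(extension_grad \<longlongrightarrow> 0) (at x)"
    proof (rule Lim_null_comparison[OF _ dist_powr_tendsto_0])
      show "\<forall>\<^sub>F y in at x. norm (extension_grad y) \<le> 4 * real m * E * dist y x powr (\<tau> - 1)"
        using eventually_near by eventually_elim (rule extension_holder_at_K(2)[OF True])
      show "0 < \<tau> - 1" using \<tau>_gt_1 by simp
    qed
    then show ?thesis using True by (simp add: isCont_def extension_grad_def)
  next
    case False
    have cont_wsum: "isCont (wsum g) x" if "bdd_on_K g" for g
      using wsum_differentiable(1)[OF False that] by (auto simp: gderiv_def dest: has_derivative_continuous)
    have "isCont (\<lambda>x. (1 / mass x) *\<^sub>R (wgrad f x - (wsum f x / mass x) *\<^sub>R wgrad (\<lambda>_. 1) x)) x"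
      using mass_pos[OF False] unfolding mass_def
      by (intro continuous_intros cont_wsum wsum_differentiable(2)[OF False] bdd_on_K_intros) auto
    moreover have "\<forall>\<^sub>F y in nhds x. extension_grad y =
        (1 / mass y) *\<^sub>R (wgrad f y - (wsum f y / mass y) *\<^sub>R wgrad (\<lambda>_. 1) y)"
      using eventually_nhds_in_open[of "- K" x] False compact_imp_closed[OF compact_K]
      by (auto elim!: eventually_mono simp: extension_grad_def extension_def open_Compl)
    ultimately show ?thesis by (simp add: isCont_cong)
  qed
  then show ?thesis by (simp add: continuous_on_eq_continuous_at)
qed

end

text \<open>
  The Whitney extension theorem for a vanishing first-order jet and a Hoelder exponent above 1,
  on compact sets of finite upper box dimension. The number m only has to be so large that
  t (1 - D / (2 m)) > 1.
\<close>
theorem whitney_extension_of_superlinear_holder: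
  fixes K :: "'a::euclidean_space set" and f :: "'a \<Rightarrow> real"
  assumes K: "compact K" "K \<noteq> {}" and C: "0 \<le> C" and t: "1 < t"
    and holder: "\<And>x y. x \<in> K \<Longrightarrow> y \<in> K \<Longrightarrow> \<bar>f x - f y\<bar> \<le> C * dist x y powr t"
    and N: "\<And>n. finite (N n)" "\<And>n. N n \<subseteq> K" "\<And>n. card (N n) \<le> B ^ n" "1 \<le> B"
    and net: "0 < r" "0 < q" "q < 1" "\<And>n x. x \<in> K \<Longrightarrow> \<exists>y\<in>N n. dist x y \<le> r * q ^ n"
  shows "\<exists>F G. (\<forall>x. GDERIV F x :> G x) \<and> continuous_on UNIV G \<and>
    (\<forall>x\<in>K. F x = f x \<and> G x = 0)"
proof -
  define D where "D = ln (1 / (2 * real B)) / ln q"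
  obtain m :: nat where m: "t + D * t / (t - 1) + 1 < 2 * real m"
  proof -
    obtain k :: nat where "t + D * t / (t - 1) + 1 < real k" using reals_Archimedean2 by blast
    then show thesis by (intro that[of k]) auto
  qed
  have "0 < D" unfolding D_def using N(4) net by (intro divide_neg_neg) auto
  then have pos: "0 < D * t / (t - 1)" using t by simp
  have m1: "t \<le> 2 * real m" "0 < 2 * real m" "D * t / (t - 1) < 2 * real m" using m pos t by linarith+
  have "1 < t * (1 - D / (2 * real m))"
  proof -
    have "D * t < 2 * real m * (t - 1)" using m1(3) t by (simp add: pos_divide_less_eq)
    then have "D * t / (2 * real m) < t - 1" using m1(2) by (simp add: pos_divide_less_eq mult.commute)
    then show ?thesis by (simp add: algebra_simps)
  qed
  then interpret netted_holder_function K f C t N B r q m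
    using assms m1(1) by unfold_locales (auto simp: D_def)
  have "\<forall>x\<in>K. extension x = f x \<and> extension_grad x = 0"
    by (simp add: extension_def extension_grad_def)
  then show ?thesis
    using gderiv_extension continuous_on_extension_grad by blast
qed

section \<open>Self-similar arcs\<close>

text \<open>
  Two nondegenerate subintervals of the unit interval that contain the same end point share a
  whole segment.
\<close>
lemma at_most_one_interval_covers_corner:
  fixes J :: "'i \<Rightarrow> real set"
  assumes ivl: "\<And>u. u \<in> U \<Longrightarrow> \<exists>l h. l < h \<and> J u = {l..h}"
    and sub: "\<And>u. u \<in> U \<Longrightarrow> J u \<subseteq> {0..1}"
    and overlap: "\<And>u v x y. \<lbrakk>u \<in> U; v \<in> U; u \<noteq> v; x \<in> J u \<inter> J v; y \<in> J u \<inter> J v\<rbrakk> \<Longrightarrow> x = y"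
    and e: "e = 0 \<or> e = 1"
  shows "finite {u \<in> U. e \<in> J u} \<and> card {u \<in> U. e \<in> J u} \<le> 1"
proof -
  have "u = v" if uv: "u \<in> U" "v \<in> U" "e \<in> J u" "e \<in> J v" for u v
  proof (rule ccontr)
    assume "u \<noteq> v"
    obtain l h where u: "l < h" "J u = {l..h}" using ivl[OF uv(1)] by blast
    obtain l' h' where v: "l' < h'" "J v = {l'..h'}" using ivl[OF uv(2)] by blast
    have bnds: "0 \<le> l" "h \<le> 1" "0 \<le> l'" "h' \<le> 1"
      using sub[OF uv(1)] sub[OF uv(2)] u v by auto
    (* an end of the common segment other than e *)
  define e' where "e' = (if e = 0 then min h h' else max l l')"
    have "e' \<in> J u \<inter> J v" "e' \<noteq> e"
      using e uv(3,4) u v bnds by (auto simp: e'_def)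
    then show False using overlap[OF uv(1,2) \<open>u \<noteq> v\<close>, of e e'] uv(3,4) by blast
  qed
  then obtain u where "{u \<in> U. e \<in> J u} \<subseteq> {u}"
    by blast
  then show ?thesis
    using card_mono[of "{u}" "{u \<in> U. e \<in> J u}"] finite_subset[of "{u \<in> U. e \<in> J u}" "{u}"] by simp
qed

text \<open>
  An arc with a fixed parametrization h, its inverse k and the contraction ratios. The
  condition on intersections is recorded in the form that passes to words of any length.
\<close>
locale similitude_arc =
  fixes \<gamma> :: "'a::euclidean_space set" and h :: "real \<Rightarrow> 'a" and k :: "'a \<Rightarrow> real"
    and I :: "'i set" and \<phi> :: "'i \<Rightarrow> 'a \<Rightarrow> 'a" and \<rho> :: "'i \<Rightarrow> real" and r :: real
  assumes param: "homeomorphism {0..1} \<gamma> h k"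
    and finite_I: "finite I"
    and attractor: "\<gamma> = (\<Union>i\<in>I. \<phi> i ` \<gamma>)"
    and similitude: "\<And>i x y. i \<in> I \<Longrightarrow> dist (\<phi> i x) (\<phi> i y) = \<rho> i * dist x y"
    and \<rho>: "\<And>i. i \<in> I \<Longrightarrow> 0 < \<rho> i \<and> \<rho> i \<le> r" and r: "0 < r" "r < 1"
    and overlap: "\<And>i j x y. \<lbrakk>i \<in> I; j \<in> I; i \<noteq> j; x \<in> \<phi> i ` \<gamma> \<inter> \<phi> j ` \<gamma>; y \<in> \<phi> i ` \<gamma> \<inter> \<phi> j ` \<gamma>\<rbrakk> \<Longrightarrow> x = y"
begin

abbreviation \<Phi> :: "'i list \<Rightarrow> 'a \<Rightarrow> 'a" where "\<Phi> u \<equiv> foldr \<phi> u"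
abbreviation ratio :: "'i list \<Rightarrow> real" where "ratio u \<equiv> prod_list (map \<rho> u)"

text \<open>
  The similitude of a word, read in the parameter of the arc.
\<close>
definition \<psi> :: "'i list \<Rightarrow> real \<Rightarrow> real" where "\<psi> u = k \<circ> \<Phi> u \<circ> h"

lemma compact_\<gamma>: "compact \<gamma>"
  using param compact_continuous_image[of "{0..1}" h] by (auto simp: homeomorphism_def)

lemma h_image: "h ` {0..1} = \<gamma>" and k_image: "k ` \<gamma> = {0..1}"
  and hk: "x \<in> \<gamma> \<Longrightarrow> h (k x) = x" and kh: "s \<in> {0..1} \<Longrightarrow> k (h s) = s"
  and cont_h: "continuous_on {0..1} h" and cont_k: "continuous_on \<gamma> k"
  using param by (auto simp: homeomorphism_def)

lemma h_mem: "s \<in> {0..1} \<Longrightarrow> h s \<in> \<gamma>"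
  using h_image by blast

lemma k_mem: "x \<in> \<gamma> \<Longrightarrow> k x \<in> {0..1}"
  using k_image by blast

lemma inj_k: "inj_on k \<gamma>"
  by (metis hk inj_onI)

lemma dist_\<Phi>: "u \<in> words I n \<Longrightarrow> dist (\<Phi> u x) (\<Phi> u y) = ratio u * dist x y"
  using similitude by (intro dist_foldr_similitudes) (auto simp: words_def)

lemma ratio_pos: "u \<in> words I n \<Longrightarrow> 0 < ratio u"
  using \<rho> by (intro prod_list_map_pos) (auto simp: words_def)

lemma ratio_le: "u \<in> words I n \<Longrightarrow> ratio u \<le> r ^ n"
  using prod_list_map_le_power[of u \<rho> r] \<rho> by (auto simp: words_def)

lemma inj_\<Phi>: "u \<in> words I n \<Longrightarrow> inj (\<Phi> u)"
  using dist_\<Phi> ratio_pos by (intro injI) (metis dist_eq_0_iff less_irrefl mult_eq_0_iff)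

lemma \<Phi>_sub: "u \<in> words I n \<Longrightarrow> \<Phi> u ` \<gamma> \<subseteq> \<gamma>"
  using attractor_eq_Union_words[OF attractor, of n] by blast

lemma \<Phi>_overlap:
  assumes "u \<in> words I n" "v \<in> words I n" "u \<noteq> v"
    and "x \<in> \<Phi> u ` \<gamma> \<inter> \<Phi> v ` \<gamma>" "y \<in> \<Phi> u ` \<gamma> \<inter> \<Phi> v ` \<gamma>"
  shows "x = y"
proof (rule foldr_similitudes_overlap[of I \<phi> \<gamma>, OF _ _ overlap assms])
  show "inj (\<phi> i)" if "i \<in> I" for i
    using similitude[OF that] \<rho>[OF that]
    by (intro injI) (metis dist_eq_0_iff less_irrefl mult_eq_0_iff)
  show "\<phi> i ` \<gamma> \<subseteq> \<gamma>" if "i \<in> I" for i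
    using attractor that by blast
qed

lemma cont_\<Phi>: "u \<in> words I n \<Longrightarrow> continuous_on S (\<Phi> u)"
  using dist_\<Phi>[of u n]
  by (intro lipschitz_on_continuous_on[of "ratio u"] lipschitz_onI) (auto intro: less_imp_le ratio_pos)

lemma \<psi>_props:
  assumes "u \<in> words I n"
  shows "continuous_on {0..1} (\<psi> u)" "inj_on (\<psi> u) {0..1}" "\<psi> u ` {0..1} = k ` (\<Phi> u ` \<gamma>)"
    "\<psi> u ` {0..1} \<subseteq> {0..1}"
proof -
  have sub: "\<Phi> u ` h ` {0..1} \<subseteq> \<gamma>"
    using \<Phi>_sub[OF assms] h_image by simp
  show "continuous_on {0..1} (\<psi> u)"
    unfolding \<psi>_def
    by (intro continuous_on_compose cont_h cont_\<Phi>[OF assms] continuous_on_subset[OF cont_k])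
      (use sub in \<open>auto simp: image_comp\<close>)
  show "inj_on (\<psi> u) {0..1}"
    unfolding \<psi>_def
    by (intro comp_inj_on inj_on_subset[OF inj_k] inj_on_subset[OF inj_\<Phi>[OF assms]])
      (use sub in \<open>auto simp: image_comp intro: inj_on_inverseI kh\<close>)
  show im: "\<psi> u ` {0..1} = k ` (\<Phi> u ` \<gamma>)"
    unfolding \<psi>_def h_image[symmetric] by (simp only: image_comp comp_assoc)
  show "\<psi> u ` {0..1} \<subseteq> {0..1}"
    unfolding im using \<Phi>_sub[OF assms] k_image by blast
qed

lemma \<psi>_interval:
  assumes "u \<in> words I n"
  shows "\<exists>l h. l < h \<and> \<psi> u ` {0..1} = {l..h}"
proof -
  have "\<psi> u ` {0..1} = closed_segment (\<psi> u 0) (\<psi> u 1)"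
    using continuous_injective_image_segment_1[of 0 1 "\<psi> u"] \<psi>_props[OF assms]
    by (simp add: closed_segment_eq_real_ivl)
  moreover have "\<psi> u 0 \<noteq> \<psi> u 1"
    using inj_on_eq_iff[OF \<psi>_props(2)[OF assms], of 0 1] by simp
  ultimately show ?thesis
    by (cases "\<psi> u 0 < \<psi> u 1") (auto simp: closed_segment_eq_real_ivl)
qed

lemma \<psi>_overlap:
  assumes uv: "u \<in> words I n" "v \<in> words I n" "u \<noteq> v"
    and "x \<in> \<psi> u ` {0..1} \<inter> \<psi> v ` {0..1}" "y \<in> \<psi> u ` {0..1} \<inter> \<psi> v ` {0..1}"
  shows "x = y"
proof -
  have sub: "\<Phi> u ` \<gamma> \<subseteq> \<gamma>" "\<Phi> v ` \<gamma> \<subseteq> \<gamma>" using \<Phi>_sub uv by auto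
  have "\<psi> u ` {0..1} \<inter> \<psi> v ` {0..1} = k ` (\<Phi> u ` \<gamma> \<inter> \<Phi> v ` \<gamma>)"
    unfolding \<psi>_props(3)[OF uv(1)] \<psi>_props(3)[OF uv(2)]
    by (rule inj_on_image_Int[OF inj_k sub, symmetric])
  then obtain x' y' where "x' \<in> \<Phi> u ` \<gamma> \<inter> \<Phi> v ` \<gamma>" "x = k x'" "y' \<in> \<Phi> u ` \<gamma> \<inter> \<Phi> v ` \<gamma>" "y = k y'"
    using assms(4,5) by (metis imageE)
  then show ?thesis using \<Phi>_overlap[OF uv, of x' y'] by simp
qed

definition inner_words :: "nat \<Rightarrow> 'i list set" where
  "inner_words n = {u \<in> words I n. \<psi> u ` {0..1} \<subseteq> {0<..<1}}"

text \<open>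
  Each end point of the arc lies in at most one piece of level n, and each summand is at most 1.
\<close>
lemma sum_inner_words_ge:
  assumes "0 \<le> t"
  shows "(\<Sum>i\<in>I. \<rho> i powr t) ^ n - 2 \<le> (\<Sum>u\<in>inner_words n. ratio u powr t)"
proof -
  define Z where "Z e = {u \<in> words I n. e \<in> \<psi> u ` {0..1}}" for e
  have Z: "finite (Z e) \<and> card (Z e) \<le> 1" if "e = 0 \<or> e = 1" for e
    unfolding Z_def
    by (rule at_most_one_interval_covers_corner[OF \<psi>_interval \<psi>_props(4) \<psi>_overlap that])
  have le_1: "ratio u powr t \<le> 1" if "u \<in> words I n" for u
  proof -
    have "ratio u \<le> 1" using ratio_le[OF that] power_le_one[of r n] r by linarith
    then show ?thesis using ratio_pos[OF that] assms by (intro powr_le1) auto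
  qed
  have sumZ: "(\<Sum>u\<in>Z e. ratio u powr t) \<le> 1" if "e = 0 \<or> e = 1" for e
  proof -
    have "(\<Sum>u\<in>Z e. ratio u powr t) \<le> real (card (Z e)) * 1"
      using le_1 by (intro sum_bounded_above) (auto simp: Z_def)
    then show ?thesis using Z[OF that] by linarith
  qed
  have "ratio u powr t = prod_list (map (\<lambda>i. \<rho> i powr t) u)" if "u \<in> words I n" for u
    using that \<rho> by (intro prod_list_map_powr) (auto simp: words_def less_imp_le subset_eq)
  then have "(\<Sum>i\<in>I. \<rho> i powr t) ^ n = (\<Sum>u\<in>words I n. ratio u powr t)"
    by (simp add: sum_words_prod_list[symmetric])
  also have "\<dots> \<le> (\<Sum>u\<in>inner_words n \<union> (Z 0 \<union> Z 1). ratio u powr t)"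
  proof (rule sum_mono2)
    show "words I n \<subseteq> inner_words n \<union> (Z 0 \<union> Z 1)"
    proof
      fix u assume u: "u \<in> words I n"
      show "u \<in> inner_words n \<union> (Z 0 \<union> Z 1)"
      proof (cases "0 \<in> \<psi> u ` {0..1} \<or> 1 \<in> \<psi> u ` {0..1}")
        case False
        have "\<psi> u ` {0..1} \<subseteq> {0<..<1}"
        proof
          fix x assume x: "x \<in> \<psi> u ` {0..1}"
          then have "x \<in> {0..1}" "x \<noteq> 0" "x \<noteq> 1" using False \<psi>_props(4)[OF u] by blast+
          then show "x \<in> {0<..<1}" by auto
        qed
        then show ?thesis using u by (simp add: inner_words_def)
      qed (use u in \<open>auto simp: Z_def\<close>)
    qed
  qed (use finite_I Z in \<open>auto simp: inner_words_def\<close>)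
  also have "\<dots> \<le> (\<Sum>u\<in>inner_words n. ratio u powr t) + (\<Sum>u\<in>Z 0 \<union> Z 1. ratio u powr t)"
    using finite_I Z sum_Un[of "inner_words n" "Z 0 \<union> Z 1" "\<lambda>u. ratio u powr t"]
      sum_nonneg[of "inner_words n \<inter> (Z 0 \<union> Z 1)" "\<lambda>u. ratio u powr t"]
    by (simp add: inner_words_def)
  also have "(\<Sum>u\<in>Z 0 \<union> Z 1. ratio u powr t) \<le> (\<Sum>u\<in>Z 0. ratio u powr t) + (\<Sum>u\<in>Z 1. ratio u powr t)"
    using Z sum_Un[of "Z 0" "Z 1" "\<lambda>u. ratio u powr t"]
      sum_nonneg[of "Z 0 \<inter> Z 1" "\<lambda>u. ratio u powr t"] by simp
  finally show ?thesis using sumZ[of 0] sumZ[of 1] by simp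
qed

text \<open>
  The function is the distribution function of the measure generated by the inner words, with
  weights at most ratio u powr t. The estimate is proved by induction on the number of times
  that a pair of points can be pulled back into a common piece: pulling back preserves the
  constant C, and a pair that shares no piece is either far apart or not distinguished by f.
\<close>
lemma exists_holder_function:
  assumes t: "0 < t" and large: "1 < (\<Sum>i\<in>I. \<rho> i powr t)"
  shows "\<exists>f C. 0 \<le> C \<and> f (h 0) = 0 \<and> f (h 1) = 1 \<and>
    (\<forall>x\<in>\<gamma>. \<forall>y\<in>\<gamma>. \<bar>f x - f y\<bar> \<le> C * dist x y powr t)"
proof -
  (* the two discarded words cost 2, so that more than 1 remains *)
  obtain n where n: "3 < (\<Sum>i\<in>I. \<rho> i powr t) ^ n"
    using real_arch_pow[OF large] by blast
  have "n \<noteq> 0" using n by (cases n) auto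
  define W where "W = inner_words n"
  have W: "u \<in> words I n" "\<psi> u ` {0..1} \<subseteq> {0<..<1}" if "u \<in> W" for u
    using that by (auto simp: W_def inner_words_def)
  have finite_W: "finite W" using finite_I by (simp add: W_def inner_words_def)
  define S where "S = (\<Sum>u\<in>W. ratio u powr t)"
  have S: "1 < S" using sum_inner_words_ge[of t n] t n by (simp add: S_def W_def)
  define p where "p u = ratio u powr t / S" for u
  have p_le: "p u \<le> ratio u powr t" for u
    using S divide_left_mono[of 1 S "ratio u powr t"] by (simp add: p_def)
  have ratio_less_1: "ratio u \<le> r" if "u \<in> W" for u
  proof -
    have "r ^ n \<le> r ^ 1" using \<open>n \<noteq> 0\<close> r by (intro power_decreasing) auto
    then show ?thesis using ratio_le[OF W(1)[OF that]] by simp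
  qed
  interpret interval_ifs W \<psi> p
  proof
    show "0 \<le> p u \<and> p u < 1" if "u \<in> W" for u
    proof
      show "0 \<le> p u" using S by (simp add: p_def)
      have "ratio u powr t < 1 powr t"
        using ratio_less_1[OF that] ratio_pos[OF W(1)[OF that]] r t by (intro powr_less_mono2) auto
      then show "p u < 1" using p_le[of u] by simp
    qed
    show "sum p W = 1"
      using S by (simp add: p_def S_def flip: sum_divide_distrib)
    show "finite W" by (rule finite_W)
    show "x = y" if "v \<in> W" "w \<in> W" "v \<noteq> w" "x \<in> \<psi> v ` {0..1} \<inter> \<psi> w ` {0..1}"
      "y \<in> \<psi> v ` {0..1} \<inter> \<psi> w ` {0..1}" for v w x y
      by (rule \<psi>_overlap[OF W(1)[OF that(1)] W(1)[OF that(2)] that(3-5)])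
  qed (use W(2) \<psi>_props(1,2)[OF W(1)] in simp_all)
  define f where "f = cdf \<circ> k"
  have f_\<Phi>: "\<bar>f (\<Phi> u x) - f (\<Phi> u y)\<bar> \<le> ratio u powr t * \<bar>f x - f y\<bar>"
    if "u \<in> W" "x \<in> \<gamma>" "y \<in> \<gamma>" for u x y
  proof -
    have "f (\<Phi> u z) = cdf (\<psi> u (k z))" if "z \<in> \<gamma>" for z
      using hk[OF that] by (simp add: f_def \<psi>_def)
    then have "\<bar>f (\<Phi> u x) - f (\<Phi> u y)\<bar> = p u * \<bar>f x - f y\<bar>"
      using cdf_self_similar[OF that(1) k_mem k_mem] that by (simp add: f_def)
    then show ?thesis using p_le[of u] by (simp add: mult_right_mono)
  qed
  have f_bounds: "0 \<le> f x" "f x \<le> 1" for x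
    using cdf_bounds[of "k x"] by (auto simp: f_def)
  obtain \<delta> where \<delta>: "0 < \<delta>"
    "\<And>s t. \<lbrakk>\<bar>s - t\<bar> < \<delta>; cdf s \<noteq> cdf t\<rbrakk> \<Longrightarrow> \<exists>w\<in>W. s \<in> \<psi> w ` {0..1} \<and> t \<in> \<psi> w ` {0..1}"
    using cdf_locally_constant_between_pieces by blast
  have "uniformly_continuous_on \<gamma> k"
    by (rule compact_uniformly_continuous[OF cont_k compact_\<gamma>])
  then obtain a where a: "0 < a" "\<And>x y. \<lbrakk>x \<in> \<gamma>; y \<in> \<gamma>; dist x y < a\<rbrakk> \<Longrightarrow> \<bar>k x - k y\<bar> < \<delta>"
    using \<delta>(1) unfolding uniformly_continuous_on_def dist_real_def by (metis dist_commute)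
  have common: "\<exists>u\<in>W. x \<in> \<Phi> u ` \<gamma> \<and> y \<in> \<Phi> u ` \<gamma>"
    if xy: "x \<in> \<gamma>" "y \<in> \<gamma>" "dist x y < a" "f x \<noteq> f y" for x y
  proof -
    obtain u where u: "u \<in> W" "k x \<in> \<psi> u ` {0..1}" "k y \<in> \<psi> u ` {0..1}"
      using \<delta>(2)[OF a(2)[OF xy(1-3)]] xy(4) by (auto simp: f_def)
    have "z \<in> \<Phi> u ` \<gamma>" if "z \<in> \<gamma>" "k z \<in> \<psi> u ` {0..1}" for z
      using that(2) unfolding \<psi>_props(3)[OF W(1)[OF u(1)]]
      using inj_on_image_mem_iff[OF inj_k that(1) \<Phi>_sub[OF W(1)[OF u(1)]]] by simp
    then show ?thesis using u xy by blast
  qed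
  define C where "C = a powr (- t)"
  have C: "0 \<le> C" by (simp add: C_def)
  (* a strict bound for all distances, so that the induction below starts vacuously *)
  define d where "d = diameter \<gamma> + 1"
  have d: "dist x y < d" if "x \<in> \<gamma>" "y \<in> \<gamma>" for x y
    using diameter_bounded_bound[OF compact_imp_bounded[OF compact_\<gamma>] that] by (simp add: d_def)
  have step: "\<bar>f x - f y\<bar> \<le> C * dist x y powr t"
    if "x \<in> \<gamma>" "y \<in> \<gamma>" "r ^ j * d \<le> dist x y" for j x y
    using that
  proof (induction j arbitrary: x y)
    case 0
    then show ?case using d[of x y] by simp
  next
    case (Suc j)
    consider "f x = f y" | "a \<le> dist x y" | "dist x y < a" "f x \<noteq> f y" by linarith
    then show ?case
    proof cases
      case 1
      then show ?thesis using C by simp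
    next
      case 2
      have "1 = C * a powr t" using a(1) by (simp add: C_def flip: powr_add)
      also have "\<dots> \<le> C * dist x y powr t" using 2 a(1) C t by (intro mult_left_mono powr_mono2) auto
      finally show ?thesis using f_bounds[of x] f_bounds[of y] by linarith
    next
      case 3
      obtain u x' y' where u: "u \<in> W" "x' \<in> \<gamma>" "y' \<in> \<gamma>" "x = \<Phi> u x'" "y = \<Phi> u y'"
        using common[OF Suc.prems(1,2) 3] by blast
      have pos: "0 < ratio u" by (rule ratio_pos[OF W(1)[OF u(1)]])
      have dist_eq: "dist x y = ratio u * dist x' y'"
        using dist_\<Phi>[OF W(1)[OF u(1)]] u(4,5) by simp
      have "r * (r ^ j * d) \<le> r * dist x' y'"
        using Suc.prems(3) dist_eq mult_right_mono[OF ratio_less_1[OF u(1)], of "dist x' y'"] by simp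
      then have "r ^ j * d \<le> dist x' y'" using r by simp
      then have "\<bar>f x' - f y'\<bar> \<le> C * dist x' y' powr t" by (rule Suc.IH[OF u(2,3)])
      then have "ratio u powr t * \<bar>f x' - f y'\<bar> \<le> ratio u powr t * (C * dist x' y' powr t)"
        by (intro mult_left_mono) auto
      also have "\<dots> = C * dist x y powr t" using pos by (simp add: dist_eq powr_mult)
      finally show ?thesis using f_\<Phi>[OF u(1-3)] u(4,5) by simp
    qed
  qed
  have holder: "\<bar>f x - f y\<bar> \<le> C * dist x y powr t" if xy: "x \<in> \<gamma>" "y \<in> \<gamma>" for x y
  proof (cases "x = y")
    case False
    have "(\<lambda>j. r ^ j * d) \<longlonglongrightarrow> 0"
      using r by (auto intro!: tendsto_eq_intros LIMSEQ_power_zero)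
    then have "\<forall>\<^sub>F j in sequentially. r ^ j * d < dist x y"
      using False by (intro order_tendstoD) auto
    then obtain j where "r ^ j * d < dist x y" by (auto simp: eventually_sequentially)
    then show ?thesis using step[OF xy, of j] by simp
  qed simp
  have "f (h 0) = 0" "f (h 1) = 1"
    using kh[of 0] kh[of 1] by (simp_all add: f_def cdf_0 cdf_1)
  then show ?thesis using C holder by blast
qed

text \<open>
  The images of one end point of the arc under the maps of level n form the nets needed for the
  extension.
\<close>
definition vertices :: "nat \<Rightarrow> 'a set" where
  "vertices n = (\<lambda>u. \<Phi> u (h 0)) ` words I n"

lemma vertices_props:
  shows "finite (vertices n)" "vertices n \<subseteq> \<gamma>" "card (vertices n) \<le> card I ^ n"
    and "x \<in> \<gamma> \<Longrightarrow> \<exists>y\<in>vertices n. dist x y \<le> (diameter \<gamma> + 1) * r ^ n"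
proof -
  have h0: "h 0 \<in> \<gamma>" by (rule h_mem) simp
  show "finite (vertices n)" using finite_I by (simp add: vertices_def)
  show "vertices n \<subseteq> \<gamma>" using \<Phi>_sub h0 unfolding vertices_def by blast
  show "card (vertices n) \<le> card I ^ n"
    unfolding vertices_def card_words[OF finite_I, symmetric]
    by (rule card_image_le) (simp add: finite_I)
  show "\<exists>y\<in>vertices n. dist x y \<le> (diameter \<gamma> + 1) * r ^ n" if "x \<in> \<gamma>"
  proof -
    obtain u z where u: "u \<in> words I n" "z \<in> \<gamma>" "x = \<Phi> u z"
      using attractor_eq_Union_words[OF attractor, of n] \<open>x \<in> \<gamma>\<close> by blast
    have "dist x (\<Phi> u (h 0)) = ratio u * dist z (h 0)" using dist_\<Phi>[OF u(1)] u(3) by simp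
    also have "\<dots> \<le> r ^ n * (diameter \<gamma> + 1)"
      using ratio_le[OF u(1)] r
        diameter_bounded_bound[OF compact_imp_bounded[OF compact_\<gamma>] u(2) h0]
      by (intro mult_mono) auto
    finally show ?thesis using u(1) by (auto simp: vertices_def mult.commute)
  qed
qed

theorem whitney_set_if_hausdorff_dim_gt_1:
  assumes "hausdorff_dim \<gamma> > 1"
  shows "whitney_set \<gamma>"
proof -
  have h01: "h 0 \<in> \<gamma>" "h 1 \<in> \<gamma>" by (auto intro: h_mem)
  have "hausdorff_dim \<gamma> > ennreal 1" using assms by simp
  then obtain t where t: "1 < t" "1 < (\<Sum>i\<in>I. \<rho> i powr t)"
    using exists_exponent_of_hausdorff_dim_gt[OF finite_I compact_\<gamma> _ attractor similitude \<rho> r, of 1] h01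
    by auto
  obtain f C where f: "0 \<le> C" "f (h 0) = 0" "f (h 1) = 1"
    "\<And>x y. x \<in> \<gamma> \<Longrightarrow> y \<in> \<gamma> \<Longrightarrow> \<bar>f x - f y\<bar> \<le> C * dist x y powr t"
    using exists_holder_function[OF _ t(2)] t(1) by auto
  have "I \<noteq> {}" using t by auto
  then have card_I: "1 \<le> card I" using finite_I by (simp add: card_gt_0_iff Suc_le_eq)
  have d: "0 < diameter \<gamma> + 1"
    using diameter_ge_0[OF compact_imp_bounded[OF compact_\<gamma>]] by linarith
  have ne: "\<gamma> \<noteq> {}" using h01 by auto
  obtain F G where FG: "\<forall>x. GDERIV F x :> G x" "continuous_on UNIV G"
    "\<And>x. x \<in> \<gamma> \<Longrightarrow> F x = f x \<and> G x = 0"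
    using whitney_extension_of_superlinear_holder[OF compact_\<gamma> ne f(1) t(1) f(4)
        vertices_props(1,2,3) card_I d r vertices_props(4)] by blast
  have "\<not> F constant_on \<gamma>"
  proof
    assume "F constant_on \<gamma>"
    then have "F (h 0) = F (h 1)" using h01 unfolding constant_on_def by metis
    then show False using FG(3)[OF h01(1)] FG(3)[OF h01(2)] f(2,3) by simp
  qed
  moreover have "connected \<gamma>"
    using connected_continuous_image[OF cont_h connected_Icc] h_image by simp
  ultimately show ?thesis
    unfolding whitney_set_def using compact_\<gamma> FG(1,2) FG(3)
    by (intro conjI exI[of _ F] exI[of _ G] ballI) auto
qed

end

theorem corollary1p2:
  fixes \<gamma> :: "(real ^ 'd) set"
  assumes "self_similar_arc \<gamma>"
    and "hausdorff_dim \<gamma> > 1"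
  shows "whitney_set \<gamma>"
proof -
  obtain h k where hk: "homeomorphism {0..1::real} \<gamma> h k"
    using assms(1) by (auto simp: self_similar_arc_def is_arc_def homeomorphic_def)
  obtain N \<phi> where sim: "\<forall>i\<in>{1..N}. contractive_similitude (\<phi> i)" and attr: "is_attractor N \<phi> \<gamma>"
    and meet: "\<forall>i\<in>{1..N}. \<forall>j\<in>{1..N}.
          (\<bar>int i - int j\<bar> = 1 \<longrightarrow> is_singleton (\<phi> i ` \<gamma> \<inter> \<phi> j ` \<gamma>)) \<and>
          (\<bar>int i - int j\<bar> > 1 \<longrightarrow> \<phi> i ` \<gamma> \<inter> \<phi> j ` \<gamma> = {})"
    using assms(1) by (auto simp: self_similar_arc_def)
  have "\<forall>i\<in>{1..N}. \<exists>\<rho>. 0 < \<rho> \<and> \<rho> < 1 \<and> (\<forall>x y. dist (\<phi> i x) (\<phi> i y) = \<rho> * dist x y)"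
    using sim by (simp add: contractive_similitude_def)
  from bchoice[OF this] obtain \<rho> where
    \<rho>: "\<forall>i\<in>{1..N}. 0 < \<rho> i \<and> \<rho> i < 1 \<and> (\<forall>x y. dist (\<phi> i x) (\<phi> i y) = \<rho> i * dist x y)" by blast
  (* the number 1 / 2 keeps r positive without a case distinction on N *)
  define r where "r = Max (insert (1 / 2) (\<rho> ` {1..N}))"
  interpret similitude_arc \<gamma> h k "{1..N}" \<phi> \<rho> r
  proof
    show "homeomorphism {0..1} \<gamma> h k" by (rule hk)
    show "\<gamma> = (\<Union>i\<in>{1..N}. \<phi> i ` \<gamma>)" using attr by (simp add: is_attractor_def)
    show "dist (\<phi> i x) (\<phi> i y) = \<rho> i * dist x y" if "i \<in> {1..N}" for i x y
      using \<rho> that by blast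
    show "0 < \<rho> i \<and> \<rho> i \<le> r" if "i \<in> {1..N}" for i
      using \<rho> that unfolding r_def by (intro conjI Max_ge) auto
    have "1 / 2 \<le> r" unfolding r_def by (intro Max_ge) auto
    then show "0 < r" by linarith
    show "r < 1" using \<rho> by (auto simp: r_def)
    show "x = y" if ij: "i \<in> {1..N}" "j \<in> {1..N}" "i \<noteq> j"
      and xy: "x \<in> \<phi> i ` \<gamma> \<inter> \<phi> j ` \<gamma>" "y \<in> \<phi> i ` \<gamma> \<inter> \<phi> j ` \<gamma>" for i j x y
    proof -
      have "\<bar>int i - int j\<bar> = 1 \<or> \<bar>int i - int j\<bar> > 1" using ij(3) by linarith
      then have "is_singleton (\<phi> i ` \<gamma> \<inter> \<phi> j ` \<gamma>)"
        using meet ij(1,2) xy(1) by blast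
      then show ?thesis using xy by (metis is_singleton_def singletonD)
    qed
  qed simp
  show ?thesis using assms(2) by (rule whitney_set_if_hausdorff_dim_gt_1)
qed

end
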